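(* Fix any $p>1$, and let $n\ge2$ be an integer. Then there exists some $C=C(p)>0$ such that $$\inf_{y_0\ge1}\mathsf{Regret}_n\big(\hat\theta_n^{\mathsf{Robbins}}(Y^n;y_0);\mathcal{G}_p(1)\big)\le C\,n^{-\frac{p-1}{p+2}}(\log n)^{\frac{3(p-1)}{p+2}}.$$ Conversely, let $y_*=\big(n/(\log n)^2\big)^{1/(p+1)}$. Then there exists some $c=c(p)>0$ such that for any $y_0\ge1$ (including $y_0=\infty$), $$\mathsf{Regret}_n\big(\hat\theta_n^{\mathsf{Robbins}}(Y^n;y_0);\mathcal{G}_p(1)\big)\ge c\cdot\Big(\frac{(y_0\wedge y_* )^3}{n}+y_0^{-(p-1)}\Big).$$ Consequently, the regrets of the untruncated and optimally truncated Robbins estimators satisfy $$\mathsf{Regret}_n\big(\hat\theta_n^{\mathsf{Robbins}}(Y^n;\infty);\mathcal{G}_p(1)\big)\ge c\,n^{-\frac{p-2}{p+1}}(\log n)^{-6},$$ $$\inf_{y_0\ge1}\mathsf{Regret}_n\big(\hat\theta_n^{\mathsf{Robbins}}(Y^n;y_0);\mathcal{G}_p(1)\big)\ge c\,n^{-\frac{p-1}{p+2}}.$$ The constants $C,c$ depend only on $p$.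
   Context: $\mathbb{R}_+=[0,\infty)$, $a\wedge b=\min\{a,b\}$, and $\infty^{-(p-1)}=0$. $\mathcal{G}_p(1)$ is the set of Borel probability measures $G$ on $\mathbb{R}_+$ with $\int u^pG(du)\le1$. Poisson empirical Bayes model with prior $G$: $\theta_1,\ldots,\theta_n$ are i.i.d. from $G$ and, given them, $Y_i\sim\mathrm{Poi}(\theta_i)$ independently; $Y^n=(Y_1,\ldots,Y_n)$. With $N_{n-1}(y)=\sum_{i=1}^{n-1}\mathbf{1}\{Y_i=y\}$, the generalized (truncated) Robbins estimator of $\theta_n$ with truncation parameter $y_0$ (a positive integer, or $\infty$) is $$\hat\theta_n^{\mathsf{Robbins}}(Y^n;y_0)=\begin{cases}(Y_n+1)\dfrac{N_{n-1}(Y_n+1)}{N_{n-1}(Y_n)+1}, & Y_n\le y_0,\\ Y_n, & Y_n>y_0.\end{cases}$$ The Bayes risk is $\mathsf{mmse}(G)=\mathbb{E}_G(\mathbb{E}_G[\theta\mid Y]-\theta)^2$ with $\theta\sim G$, $Y\mid\theta\sim\mathrm{Poi}(\theta)$, and the individual regret of an estimator $\hat\theta$ of $\theta_n$ is $\mathsf{Regret}_n(\hat\theta;\mathcal{G})=\sup_{G\in\mathcal{G}}\{\mathbb{E}_G(\hat\theta(Y^n)-\theta_n)^2-\mathsf{mmse}(G)\}$. *)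

theory Defs
  imports "HOL-Probability.Probability" "HOL-Library.Extended_Nat"
begin

(* poisson_pmf is only specified for positive rates; Poi(0) is the point mass at 0. The prior is
   carried by the nonnegative reals, so the value chosen for negative rates is immaterial. *)
definition poi :: "real \<Rightarrow> nat pmf" where
  "poi t = (if t > 0 then poisson_pmf t else return_pmf 0)"

(* A Borel probability measure on [0,\<infinity>) is represented by a Borel probability measure on the
   whole line that gives no mass to the negative half-line. The moment is a nonnegative
   extended integral, so an infinite p-th moment is excluded. *)
definition moment_class :: "real \<Rightarrow> real measure set" where
  "moment_class p = {G. prob_space G \<and> sets G = sets borel \<and> (AE u in G. 0 \<le> u) \<and>
     (\<integral>\<^sup>+ u. ennreal (u powr p) \<partial>G) \<le> 1}"

(* Joint law of (\<theta>, Y) with \<theta> ~ G and Y | \<theta> ~ Poi(\<theta>): its density with respect to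
   G times counting measure is the conditional mass function. *)
definition joint_law :: "real measure \<Rightarrow> (real \<times> nat) measure" where
  "joint_law G = density (G \<Otimes>\<^sub>M count_space UNIV) (\<lambda>(t, y). ennreal (pmf (poi t) y))"

definition sample_law :: "nat \<Rightarrow> real measure \<Rightarrow> (nat \<Rightarrow> real \<times> nat) measure" where
  "sample_law n G = (\<Pi>\<^sub>M i\<in>{1..n}. joint_law G)"

definition posterior_mean :: "real measure \<Rightarrow> real \<times> nat \<Rightarrow> real" where
  "posterior_mean G =
     real_cond_exp (joint_law G)
       (vimage_algebra (space (joint_law G)) snd (count_space UNIV)) fst"

definition mmse :: "real measure \<Rightarrow> ennreal" where
  "mmse G = (\<integral>\<^sup>+ x. ennreal ((posterior_mean G x - fst x)\<^sup>2) \<partial>joint_law G)"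

definition risk :: "nat \<Rightarrow> ((nat \<Rightarrow> nat) \<Rightarrow> real) \<Rightarrow> real measure \<Rightarrow> ennreal" where
  "risk n est G =
     (\<integral>\<^sup>+ \<omega>. ennreal ((est (\<lambda>i. snd (\<omega> i)) - fst (\<omega> n))\<^sup>2) \<partial>sample_law n G)"

(* Values in ereal, so that the supremum is the genuine one even if it is infinite. *)
definition regret :: "nat \<Rightarrow> ((nat \<Rightarrow> nat) \<Rightarrow> real) \<Rightarrow> real measure set \<Rightarrow> ereal" where
  "regret n est \<G> = (SUP G\<in>\<G>. enn2ereal (risk n est G) - enn2ereal (mmse G))"

definition count_upto :: "nat \<Rightarrow> (nat \<Rightarrow> nat) \<Rightarrow> nat \<Rightarrow> nat" where
  "count_upto m Y y = card {i \<in> {1..m}. Y i = y}"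

definition robbins :: "nat \<Rightarrow> enat \<Rightarrow> (nat \<Rightarrow> nat) \<Rightarrow> real" where
  "robbins n y0 Y =
     (if enat (Y n) \<le> y0
      then real (Y n + 1) * real (count_upto (n - 1) Y (Y n + 1))
             / real (count_upto (n - 1) Y (Y n) + 1)
      else real (Y n))"

definition robbins_regret :: "real \<Rightarrow> nat \<Rightarrow> enat \<Rightarrow> ereal" where
  "robbins_regret p n y0 = regret n (robbins n y0) (moment_class p)"

definition enat_min_real :: "enat \<Rightarrow> real \<Rightarrow> real" where
  "enat_min_real y0 b = (case y0 of enat k \<Rightarrow> min (real k) b | \<infinity> \<Rightarrow> b)"

(* y0 ^ (-a) with the convention \<infinity> ^ (-a) = 0; used for a > 0 only. *)
definition enat_powr_minus :: "enat \<Rightarrow> real \<Rightarrow> real" where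
  "enat_powr_minus y0 a = (case y0 of enat k \<Rightarrow> real k powr (- a) | \<infinity> \<Rightarrow> 0)"

definition y_star :: "real \<Rightarrow> nat \<Rightarrow> real" where
  "y_star p n = (real n / (ln (real n))\<^sup>2) powr (1 / (p + 1))"

end

theory Submission
  imports Defs "HOL-Real_Asymp.Real_Asymp"
begin

text \<open>
  Write \<open>f\<close> for the marginal mass function of \<open>Y\<close> and \<open>\<theta>(y) = (y + 1) f(y + 1) / f(y)\<close> for the Bayes rule.
  Since the mmse is finite, the excess risk of an estimator at a prior is exactly the sum over
  \<open>y\<close> of \<open>f(y) E (\<theta>\<^sub>n(y) - \<theta>(y))\<^sup>2\<close>. For the Robbins estimator with \<open>y \<le> y0\<close> this
  involves only \<open>A = N(y)\<close>, which is binomial with parameters \<open>m = n - 1\<close> and \<open>f(y)\<close>, and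
  \<open>B = N(y + 1)\<close>, which given \<open>A\<close> is binomial with parameters \<open>m - A\<close> and \<open>q = f(y + 1) / (1 - f(y))\<close>. The
  conditional variance of \<open>B\<close> and the fluctuation of \<open>A\<close> are controlled by the size-bias
  identities for \<open>1 / ((A + 1) (A + 2))\<close>, and give a contribution of order
  \<open>(\<theta>(y)\<^sup>2 + (y + 1) \<theta>(y)) min(f(y), 1 / n)\<close>. Because \<open>Poi(t)\<close> gives mass at most \<open>2\<^sup>y exp(- t / 2)\<close> to
  \<open>y\<close>, one may replace \<open>\<theta>(y)\<close> here by a constant times \<open>y0 + log n\<close>; the terms \<open>y > y0\<close> are at
  most the truncated variance \<open>E (Y - \<theta>)\<^sup>2 1{Y > y0}\<close>, of order \<open>y0\<close> to the power \<open>-(p - 1)\<close>.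

  For the lower bounds, two priors suffice. A two-point prior on \<open>0\<close> and \<open>16 y0\<close> makes the
  Bayes rule constant for \<open>y > y0\<close>, so that truncation costs the variance. A mixture of the point
  mass at \<open>0\<close> with an exponential law of mean \<open>K \<le> min(y0, y\<^sub>*)\<close> has a geometric marginal of order at least
  \<open>1 / n\<close> on \<open>{1..K}\<close>, so that the conditional variance of \<open>B\<close> alone contributes order \<open>y\<^sup>2 / n\<close> for
  each \<open>y \<le> K\<close>.
\<close>

section \<open>Binomial and trinomial sums\<close>

text \<open>For \<open>x + z = 1\<close> this is the expectation of \<open>\<psi>\<close> at a
  binomial count with success probability \<open>x\<close>. The two weights are independent of each
  other, so that the recursions are polynomial identities.\<close>

definition binsum :: "nat \<Rightarrow> real \<Rightarrow> real \<Rightarrow> (nat \<Rightarrow> real) \<Rightarrow> real" where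
  "binsum n x z \<psi> = (\<Sum>a\<le>n. real (n choose a) * x ^ a * z ^ (n - a) * \<psi> a)"

lemma binsum_0 [simp]: "binsum 0 x z \<psi> = \<psi> 0"
  by (simp add: binsum_def)

lemma binsum_add: "binsum n x z (\<lambda>a. \<psi> a + \<phi> a) = binsum n x z \<psi> + binsum n x z \<phi>"
  by (simp add: binsum_def algebra_simps sum.distrib)

lemma binsum_cmult: "binsum n x z (\<lambda>a. c * \<psi> a) = c * binsum n x z \<psi>"
  by (simp add: binsum_def sum_distrib_left mult_ac)

lemma binsum_cong: "(\<And>a. a \<le> n \<Longrightarrow> \<psi> a = \<phi> a) \<Longrightarrow> binsum n x z \<psi> = binsum n x z \<phi>"
  by (simp add: binsum_def)

lemma binsum_mono:
  assumes "0 \<le> x" "0 \<le> z" "\<And>a. a \<le> n \<Longrightarrow> \<psi> a \<le> \<phi> a"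
  shows "binsum n x z \<psi> \<le> binsum n x z \<phi>"
  unfolding binsum_def using assms by (intro sum_mono mult_left_mono) auto

lemma binsum_nonneg:
  assumes "0 \<le> x" "0 \<le> z" "\<And>a. a \<le> n \<Longrightarrow> 0 \<le> \<psi> a"
  shows "0 \<le> binsum n x z \<psi>"
  unfolding binsum_def using assms by (intro sum_nonneg mult_nonneg_nonneg) auto

text \<open>Pascal's rule, read as conditioning on one trial.\<close>

lemma binsum_Suc:
  "binsum (Suc n) x z \<psi> = x * binsum n x z (\<lambda>a. \<psi> (Suc a)) + z * binsum n x z \<psi>"
proof -
  have "binsum (Suc n) x z \<psi> = z ^ Suc n * \<psi> 0 +
      (\<Sum>a\<le>n. real (Suc n choose Suc a) * x ^ Suc a * z ^ (n - a) * \<psi> (Suc a))"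
    by (simp add: binsum_def sum.atMost_Suc_shift del: sum.atMost_Suc)
  also have "(\<Sum>a\<le>n. real (Suc n choose Suc a) * x ^ Suc a * z ^ (n - a) * \<psi> (Suc a)) =
      x * binsum n x z (\<lambda>a. \<psi> (Suc a)) +
      (\<Sum>a\<le>n. real (n choose Suc a) * x ^ Suc a * z ^ (n - a) * \<psi> (Suc a))"
    by (simp add: binsum_def sum_distrib_left sum.distrib algebra_simps)
  also have "(\<Sum>a\<le>n. real (n choose Suc a) * x ^ Suc a * z ^ (n - a) * \<psi> (Suc a)) =
      z * (\<Sum>a<n. real (n choose Suc a) * x ^ Suc a * z ^ (n - Suc a) * \<psi> (Suc a))"
  proof (cases n)
    case (Suc k)
    have "(\<Sum>a\<le>n. real (n choose Suc a) * x ^ Suc a * z ^ (n - a) * \<psi> (Suc a)) =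
      (\<Sum>a<n. real (n choose Suc a) * x ^ Suc a * z ^ (n - a) * \<psi> (Suc a))"
      by (simp add: lessThan_Suc_atMost[symmetric])
    also have "\<dots> = (\<Sum>a<n. z * (real (n choose Suc a) * x ^ Suc a * z ^ (n - Suc a) * \<psi> (Suc a)))"
    proof (rule sum.cong[OF refl])
      fix a assume "a \<in> {..<n}"
      then have "n - a = Suc (n - Suc a)" by auto
      then show "real (n choose Suc a) * x ^ Suc a * z ^ (n - a) * \<psi> (Suc a) =
         z * (real (n choose Suc a) * x ^ Suc a * z ^ (n - Suc a) * \<psi> (Suc a))"
        by simp
    qed
    finally show ?thesis by (simp add: sum_distrib_left)
  qed simp
  also have "(\<Sum>a<n. real (n choose Suc a) * x ^ Suc a * z ^ (n - Suc a) * \<psi> (Suc a)) =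
      binsum n x z \<psi> - z ^ n * \<psi> 0"
    by (simp add: binsum_def lessThan_Suc_atMost[symmetric] sum.lessThan_Suc_shift del: sum.lessThan_Suc)
  finally show ?thesis by (simp add: algebra_simps)
qed

text \<open>Size bias: by absorption
  \<open>(a + 1) * (m + 1 choose a + 1) = (m + 1) * (m choose a)\<close>, so a factor
  \<open>1 / (a + 1)\<close> is traded for one more trial. The subtracted term is the value at zero
  successes, which the shift cannot reach.\<close>

lemma binsum_sizebias:
  "real (Suc m) * x * binsum m x z (\<lambda>a. \<psi> (Suc a) / real (Suc a)) =
     binsum (Suc m) x z \<psi> - z ^ Suc m * \<psi> 0"
proof -
  have "real (Suc m) * x * binsum m x z (\<lambda>a. \<psi> (Suc a) / real (Suc a)) =
    (\<Sum>a\<le>m. real (Suc m choose Suc a) * x ^ Suc a * z ^ (m - a) * \<psi> (Suc a))"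
    unfolding binsum_def sum_distrib_left
  proof (rule sum.cong[OF refl])
    fix a
    have "real (Suc m choose Suc a) = real (Suc m) * real (m choose a) / real (Suc a)"
      using Suc_times_binomial_eq[of m a]
      by (metis nonzero_mult_div_cancel_right of_nat_eq_0_iff of_nat_mult nat.distinct(2))
    then show "real (Suc m) * x * (real (m choose a) * x ^ a * z ^ (m - a) * (\<psi> (Suc a) / real (Suc a))) =
       real (Suc m choose Suc a) * x ^ Suc a * z ^ (m - a) * \<psi> (Suc a)"
      by (simp add: field_simps del: binomial_Suc_Suc of_nat_Suc)
  qed
  also have "\<dots> = binsum (Suc m) x z \<psi> - z ^ Suc m * \<psi> 0"
    by (simp add: binsum_def sum.atMost_Suc_shift del: sum.atMost_Suc)
  finally show ?thesis .
qed

text \<open>The companion absorption identity: weighting by the number of failures removes one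
  failed trial.\<close>

lemma binsum_remaining:
  "binsum (Suc m) x z (\<lambda>a. real (Suc m - a) * \<psi> a) = real (Suc m) * z * binsum m x z \<psi>"
proof -
  have "binsum (Suc m) x z (\<lambda>a. real (Suc m - a) * \<psi> a) =
    (\<Sum>a\<le>m. real (Suc m choose a) * x ^ a * z ^ (Suc m - a) * (real (Suc m - a) * \<psi> a))"
    by (simp add: binsum_def)
  also have "\<dots> = real (Suc m) * z * binsum m x z \<psi>"
    unfolding binsum_def sum_distrib_left
  proof (rule sum.cong[OF refl])
    fix a assume "a \<in> {..m}"
    then have a: "a \<le> m" by simp
    have "(Suc m - a) * (Suc m choose a) = Suc m * (m choose a)"
      using a binomial_absorb_comp[of "Suc m" a] by simp
    then have "real (Suc m - a) * real (Suc m choose a) = real (Suc m) * real (m choose a)"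
      by (metis of_nat_mult)
    moreover have "Suc m - a = Suc (m - a)" using a by simp
    ultimately show "real (Suc m choose a) * x ^ a * z ^ (Suc m - a) * (real (Suc m - a) * \<psi> a) =
       real (Suc m) * z * (real (m choose a) * x ^ a * z ^ (m - a) * \<psi> a)"
      by (metis (no_types, opaque_lifting) mult.assoc mult.left_commute power_Suc)
  qed
  finally show ?thesis .
qed

lemma binsum_one: "x + z = 1 \<Longrightarrow> binsum n x z (\<lambda>_. 1) = 1"
  by (induction n) (simp_all add: binsum_Suc)

text \<open>Variance plus squared bias of a binomial count. The centre \<open>c\<close> is kept
  general in the induction because a success turns it into \<open>c - 1\<close>.\<close>

lemma binsum_square:
  assumes "x + z = 1"
  shows "binsum n x z (\<lambda>a. (real a - c)\<^sup>2) = real n * x * z + (real n * x - c)\<^sup>2"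
proof (induction n arbitrary: c)
  case (Suc n)
  have z: "z = 1 - x" using assms by simp
  have IH: "binsum n x z (\<lambda>a. (real (Suc a) - c)\<^sup>2) = real n * x * z + (real n * x - (c - 1))\<^sup>2"
    using Suc.IH[of "c - 1"] by (simp add: algebra_simps)
  show ?case
    unfolding binsum_Suc IH Suc.IH[of c] unfolding z
    by (simp add: power2_eq_square algebra_simps)
qed simp

text \<open>Two size-bias steps, each dropping the nonnegative term at zero successes.\<close>

lemma binsum_inverse_pair_le:
  assumes "0 < x" "0 \<le> z" "\<And>a. 0 \<le> \<psi> a"
  shows "binsum m x z (\<lambda>a. \<psi> (a + 2) / (real (a + 1) * real (a + 2)))
    \<le> binsum (m + 2) x z \<psi> / (real (m + 1) * real (m + 2) * x\<^sup>2)"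
proof -
  define \<phi> where "\<phi> a = \<psi> (Suc a) / real (Suc a)" for a
  have "real (Suc m) * x * binsum m x z (\<lambda>a. \<phi> (Suc a) / real (Suc a)) \<le> binsum (Suc m) x z \<phi>"
    unfolding binsum_sizebias using assms by (simp add: \<phi>_def)
  moreover have "real (Suc (Suc m)) * x * binsum (Suc m) x z \<phi> \<le> binsum (Suc (Suc m)) x z \<psi>"
    unfolding binsum_sizebias \<phi>_def using assms by simp
  ultimately have "real (Suc (Suc m)) * x * (real (Suc m) * x * binsum m x z (\<lambda>a. \<phi> (Suc a) / real (Suc a)))
     \<le> binsum (Suc (Suc m)) x z \<psi>"
    using assms by (meson mult_left_mono mult_nonneg_nonneg of_nat_0_le_iff order_trans less_imp_le)
  moreover have "(\<lambda>a. \<phi> (Suc a) / real (Suc a)) = (\<lambda>a. \<psi> (a + 2) / (real (a + 1) * real (a + 2)))"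
    by (simp add: \<phi>_def fun_eq_iff mult.commute)
  ultimately show ?thesis
    using assms(1) by (subst pos_le_divide_eq) (simp_all add: power2_eq_square mult_ac)
qed

text \<open>Removing one failure and then applying size bias twice leads from \<open>m\<close> to
  \<open>m + 1\<close> trials without loss. The bracket is the probability of at least two successes
  among \<open>m + 1\<close> trials.\<close>

lemma binsum_remaining_inverse_pair:
  assumes "0 < x" "x + z = 1"
  shows "binsum m x z (\<lambda>a. real (m - a) / (real (a + 1) * real (a + 2)))
    = z / (real (m + 1) * x\<^sup>2) * (1 - z ^ (m + 1) - real (m + 1) * x * z ^ m)"
proof (cases m)
  case 0
  then show ?thesis using assms(2) by simp
next
  case (Suc k)
  define \<phi> where "\<phi> a = 1 / real (Suc a)" for a
  have 1: "binsum m x z (\<lambda>a. real (m - a) / (real (a + 1) * real (a + 2))) =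
     real m * z * binsum k x z (\<lambda>a. \<phi> (Suc a) / real (Suc a))"
    unfolding Suc binsum_remaining[symmetric] by (simp add: \<phi>_def mult.commute)
  have 2: "real m * x * binsum k x z (\<lambda>a. \<phi> (Suc a) / real (Suc a)) = binsum m x z \<phi> - z ^ m"
    unfolding Suc binsum_sizebias by (simp add: \<phi>_def)
  have 3: "real (Suc m) * x * binsum m x z \<phi> = 1 - z ^ Suc m"
    unfolding \<phi>_def binsum_sizebias[of m x z "\<lambda>_. 1"] using binsum_one[OF assms(2), of "Suc m"] by simp
  have "real (Suc m) * x\<^sup>2 * (real m * binsum k x z (\<lambda>a. \<phi> (Suc a) / real (Suc a))) =
    1 - z ^ (m+1) - real (m + 1) * x * z ^ m"
  proof -
    have "real (Suc m) * x\<^sup>2 * (real m * binsum k x z (\<lambda>a. \<phi> (Suc a) / real (Suc a))) =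
      real (Suc m) * x * (real m * x * binsum k x z (\<lambda>a. \<phi> (Suc a) / real (Suc a)))"
      by (simp add: power2_eq_square)
    also have "\<dots> = real (Suc m) * x * binsum m x z \<phi> - real (Suc m) * x * z ^ m"
      unfolding 2 by (simp add: right_diff_distrib)
    finally show ?thesis unfolding 3 by simp
  qed
  then have "real m * binsum k x z (\<lambda>a. \<phi> (Suc a) / real (Suc a)) =
     (1 - z ^ (m+1) - real (m + 1) * x * z ^ m) / (real (m + 1) * x\<^sup>2)"
    using assms(1) by (subst eq_divide_eq) (simp add: mult_ac)
  then have "z * (real m * binsum k x z (\<lambda>a. \<phi> (Suc a) / real (Suc a))) =
     z * ((1 - z ^ (m+1) - real (m + 1) * x * z ^ m) / (real (m + 1) * x\<^sup>2))"
    by simp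
  with 1 show ?thesis by (simp add: mult_ac)
qed

text \<open>
  The expectation of \<open>\<phi>\<close> at the numbers of outcomes of probability \<open>x\<close> and \<open>y\<close> in \<open>m\<close> trials; the
  recursion conditions on the last trial, \<open>z\<close> being the probability of any other outcome.
\<close>

primrec trisum :: "nat \<Rightarrow> real \<Rightarrow> real \<Rightarrow> real \<Rightarrow> (nat \<Rightarrow> nat \<Rightarrow> real) \<Rightarrow> real" where
  "trisum 0 x y z \<phi> = \<phi> 0 0"
| "trisum (Suc m) x y z \<phi> = x * trisum m x y z (\<lambda>a b. \<phi> (Suc a) b)
     + y * trisum m x y z (\<lambda>a b. \<phi> a (Suc b)) + z * trisum m x y z \<phi>"

lemma trisum_nonneg:
  assumes "0 \<le> x" "0 \<le> y" "0 \<le> z" "\<And>a b. 0 \<le> \<phi> a b"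
  shows "0 \<le> trisum m x y z \<phi>"
  using assms(4) by (induction m arbitrary: \<phi>) (simp_all add: assms(1-3))

text \<open>Given the first count \<open>a\<close>, the second is binomial over the remaining
  \<open>m - a\<close> trials with probability \<open>y / s\<close>. In the induction the two
  branches other than \<open>x\<close> merge into one more trial of the inner sum.\<close>

lemma trisum_eq_binsum:
  assumes "s = y + z" "s \<noteq> 0"
  shows "trisum m x y z \<phi> = binsum m x s (\<lambda>a. binsum (m - a) (y / s) (z / s) (\<phi> a))"
proof (induction m arbitrary: \<phi>)
  case (Suc m)
  have "binsum m x s (\<lambda>a. binsum (Suc m - a) (y / s) (z / s) (\<phi> a)) =
     binsum m x s (\<lambda>a. y / s * binsum (m - a) (y / s) (z / s) (\<lambda>b. \<phi> a (Suc b))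
       + z / s * binsum (m - a) (y / s) (z / s) (\<phi> a))"
    by (intro binsum_cong) (simp add: Suc_diff_le binsum_Suc)
  also have "\<dots> = y / s * trisum m x y z (\<lambda>a b. \<phi> a (Suc b)) + z / s * trisum m x y z \<phi>"
    by (simp only: binsum_add binsum_cmult Suc.IH)
  finally have "s * binsum m x s (\<lambda>a. binsum (Suc m - a) (y / s) (z / s) (\<phi> a)) =
     y * trisum m x y z (\<lambda>a b. \<phi> a (Suc b)) + z * trisum m x y z \<phi>"
    using assms(2) by (simp add: field_simps)
  then show ?case
    unfolding binsum_Suc by (simp add: Suc.IH)
qed simp

text \<open>The mean squared error of \<open>b / (a + 1)\<close> as an estimate of
  \<open>y / x\<close>. For \<open>x = f(y)\<close> and \<open>y = f(y + 1)\<close> it is the error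
  of the Robbins rule at one observation, without the factor \<open>(y + 1)\<^sup>2\<close>.\<close>

definition ratio_risk :: "nat \<Rightarrow> real \<Rightarrow> real \<Rightarrow> real" where
  "ratio_risk m x y =
     trisum m x y (1 - x - y) (\<lambda>a b. (real b / real (a + 1) - y / x)\<^sup>2)"

lemma ratio_risk_nonneg:
  assumes "0 \<le> x" "0 \<le> y" "x + y \<le> 1"
  shows "0 \<le> ratio_risk m x y"
  unfolding ratio_risk_def using assms by (intro trisum_nonneg) auto

text \<open>Conditioning on the first count splits the risk into a variance and a squared bias.\<close>

lemma ratio_risk_eq:
  fixes x y :: real
  defines "s \<equiv> 1 - x" and "q \<equiv> y / (1 - x)"
  assumes "x > 0" "x < 1"
  shows "ratio_risk m x y = binsum m x s (\<lambda>a. real (m - a) * q * (1 - q) / (real (a + 1))\<^sup>2)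
     + binsum m x s (\<lambda>a. (real (m - a) * q / real (a + 1) - y / x)\<^sup>2)"
proof -
  have s: "s > 0" using assms by simp
  have q1: "(1 - x - y) / s = 1 - q" using s by (simp add: s_def q_def field_simps)
  have inner: "binsum (m - a) q (1 - q) (\<lambda>b. (real b / real (a + 1) - y / x)\<^sup>2) =
     real (m - a) * q * (1 - q) / (real (a + 1))\<^sup>2 + (real (m - a) * q / real (a + 1) - y / x)\<^sup>2" for a
  proof -
    have eq: "(t / real (a + 1) - y / x)\<^sup>2 = 1 / (real (a + 1))\<^sup>2 * (t - y / x * real (a + 1))\<^sup>2" for t
    proof -
      have "t / real (a + 1) - y / x = (t - y / x * real (a + 1)) / real (a + 1)"
        by (simp add: diff_divide_distrib del: of_nat_add of_nat_Suc)
      then show ?thesis by (simp add: power_divide)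
    qed
    have "binsum (m - a) q (1 - q) (\<lambda>b. (real b / real (a + 1) - y / x)\<^sup>2) =
      1 / (real (a + 1))\<^sup>2 * (real (m - a) * q * (1 - q) + (real (m - a) * q - y / x * real (a + 1))\<^sup>2)"
      unfolding eq binsum_cmult by (subst binsum_square) auto
    then show ?thesis unfolding eq by (simp add: distrib_left)
  qed
  have "ratio_risk m x y = binsum m x s (\<lambda>a. binsum (m - a) (y / s) ((1 - x - y) / s)
        (\<lambda>b. (real b / real (a + 1) - y / x)\<^sup>2))"
    unfolding ratio_risk_def using s by (intro trisum_eq_binsum) (auto simp: s_def)
  also have "y / s = q" by (simp add: s_def q_def)
  finally show ?thesis unfolding q1 inner binsum_add .
qed

text \<open>Brings the inverse square into the form to which two size-bias steps apply, at the price
  of a factor 2.\<close>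

lemma inverse_square_le: "1 / (real (a + 1))\<^sup>2 \<le> 2 * (1 / (real (a + 1) * real (a + 2)))"
proof -
  have "real (a + 1) * real (a + 2) \<le> 2 * (real (a + 1))\<^sup>2"
    by (simp add: power2_eq_square algebra_simps)
  then show ?thesis
    by (simp add: divide_simps power2_eq_square mult_ac del: of_nat_add of_nat_Suc)
qed

text \<open>Only the conditional variance is kept; after replacing \<open>(a + 1)\<^sup>2\<close> by
  the larger \<open>(a + 1) * (a + 2)\<close> its expectation is known exactly.\<close>

lemma ratio_risk_ge:
  fixes x y :: real
  defines "q \<equiv> y / (1 - x)"
  assumes xy: "0 < x" "x < 1" "0 \<le> y" "x + y \<le> 1"
  shows "x * ratio_risk m x y \<ge> y / x * (1 - q) / real (m + 1)
    * (1 - (1 - x) ^ (m + 1) - real (m + 1) * x * (1 - x) ^ m)"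
proof -
  have q: "0 \<le> q" "q \<le> 1" using xy by (auto simp: q_def field_simps)
  have "q * (1 - q) * binsum m x (1 - x) (\<lambda>a. real (m - a) / (real (a + 1) * real (a + 2))) \<le> ratio_risk m x y"
  proof -
    have "q * (1 - q) * binsum m x (1 - x) (\<lambda>a. real (m - a) / (real (a + 1) * real (a + 2))) \<le>
      binsum m x (1 - x) (\<lambda>a. real (m - a) * q * (1 - q) / (real (a + 1))\<^sup>2)"
      unfolding binsum_cmult[symmetric]
    proof (rule binsum_mono)
      fix a
      have "real (a + 1) * real (a + 1) \<le> real (a + 1) * real (a + 2)" by (intro mult_left_mono) auto
      then have "real (m - a) * q * (1 - q) / (real (a + 1) * real (a + 2)) \<le> real (m - a) * q * (1 - q) / (real (a + 1) * real (a + 1))"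
        using q by (intro divide_left_mono) auto
      then show "q * (1 - q) * (real (m - a) / (real (a + 1) * real (a + 2))) \<le>
         real (m - a) * q * (1 - q) / (real (a + 1))\<^sup>2"
        by (simp add: power2_eq_square mult_ac)
    qed (use xy in auto)
    moreover have "0 \<le> binsum m x (1 - x) (\<lambda>a. (real (m - a) * q / real (a + 1) - y / x)\<^sup>2)"
      using xy by (intro binsum_nonneg) auto
    ultimately show ?thesis unfolding ratio_risk_eq[OF xy(1,2)] q_def by linarith
  qed
  then have "x * (q * (1 - q) * ((1 - x) / (real (m + 1) * x\<^sup>2) * (1 - (1 - x) ^ (m + 1) - real (m + 1) * x * (1 - x) ^ m)))
    \<le> x * ratio_risk m x y"
    using xy by (intro mult_left_mono) (use binsum_remaining_inverse_pair[of x "1 - x" m] in auto)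
  moreover have "x * (q * (1 - q) * ((1 - x) / (real (m + 1) * x\<^sup>2) * P)) = y / x * (1 - q) / real (m + 1) * P" for P
  proof -
    have "x * (q * (1 - q) * ((1 - x) / (real (m + 1) * x\<^sup>2) * P)) = (q * (1 - x)) / x * (1 - q) / real (m + 1) * P"
      using xy(1) by (simp add: power2_eq_square mult_ac)
    also have "q * (1 - x) = y" using xy by (simp add: q_def)
    finally show ?thesis .
  qed
  ultimately show ?thesis by simp
qed

text \<open>With \<open>n = m + 1\<close> there are two regimes. If \<open>n * x < 1\<close>, the
  denominators are bounded below by 1 and every term is estimated pointwise, which leaves the factor
  \<open>x\<close>. Otherwise the size-bias bounds give order \<open>1 / n\<close> for the variance
  and for the squared bias.\<close>

lemma ratio_risk_le:
  fixes x y :: real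
  assumes xy: "0 < x" "x < 1" "0 \<le> y" "x + y \<le> 1" and m: "m \<ge> 1"
  shows "x * ratio_risk m x y \<le> 6 * (y / x + (y / x)\<^sup>2) * min x (1 / real (m + 1))"
proof -
  define q s r where "q = y / (1 - x)" and "s = 1 - x" and "r = y / x"
  define n where "n = real (m + 1)"
  have n: "n \<ge> 2" using m by (simp add: n_def)
  have s: "s > 0" "s \<le> 1" using xy by (auto simp: s_def)
  have q: "0 \<le> q" "q \<le> 1" using xy by (auto simp: q_def field_simps)
  have ys: "y = q * s" using s by (simp add: q_def s_def)
  have r: "r \<ge> 0" using xy by (simp add: r_def)
  have yx: "y = r * x" using xy by (simp add: r_def)
  have one: "binsum k x s (\<lambda>_. 1) = 1" for k by (rule binsum_one) (simp add: s_def)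
  have const: "binsum k x s (\<lambda>_. c) = c" for k c
    using binsum_cmult[of k x s c "\<lambda>_. 1"] one by simp
  define U where "U = binsum m x s (\<lambda>a. real (m - a) * q * (1 - q) / (real (a + 1))\<^sup>2)"
  define W where "W = binsum m x s (\<lambda>a. (real (m - a) * q / real (a + 1) - y / x)\<^sup>2)"
  have risk: "ratio_risk m x y = U + W"
    unfolding ratio_risk_eq[OF xy(1,2)] U_def W_def q_def s_def ..
  have qle: "q \<le> 2 * y" if "x \<le> 1/2"
  proof -
    have "q * (1/2) \<le> q * s" using that q by (intro mult_left_mono) (auto simp: s_def)
    then show ?thesis using ys by simp
  qed
  show ?thesis
  proof (cases "n * x < 1")
    case True
    have xn: "x < 1 / n" using True n by (simp add: field_simps)
    also have "\<dots> \<le> 1/2" using n by (simp add: field_simps)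
    finally have x2: "x \<le> 1/2" by simp
    \<comment> \<open>Here \<open>m * q\<close> is at most \<open>2 * r\<close>, so the numerators
      are bounded whatever the first count is.\<close>
    have mx: "real m \<le> 1 / x" using xn n xy(1) by (simp add: n_def field_simps)
    have mq: "real m * q \<le> (1 / x) * (2 * y)"
      using mx qle[OF x2] q xy by (intro mult_mono) auto
    have "U \<le> binsum m x s (\<lambda>_. 2 * r)"
      unfolding U_def
    proof (rule binsum_mono)
      fix a
      have "real (m - a) * q * (1 - q) / (real (a + 1))\<^sup>2 \<le> real (m - a) * q * (1 - q) / 1"
        using q by (intro divide_left_mono) (auto simp: one_le_power)
      also have "\<dots> = real (m - a) * q * (1 - q)" by simp
      also have "\<dots> \<le> real m * q" using q mult_mono[of "real (m - a) * q" "real m * q" "1 - q" 1] by (simp add: mult_right_mono)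
      also note mq
      finally show "real (m - a) * q * (1 - q) / (real (a + 1))\<^sup>2 \<le> 2 * r" by (simp add: r_def)
    qed (use xy s in auto)
    then have U: "U \<le> 2 * r" by (simp add: const)
    have "W \<le> binsum m x s (\<lambda>_. 4 * r\<^sup>2)"
      unfolding W_def
    proof (rule binsum_mono)
      fix a
      have "real (m - a) * q / real (a + 1) \<le> real (m - a) * q / 1"
        using q by (intro divide_left_mono) auto
      also have "\<dots> \<le> real m * q" using q by (simp add: mult_right_mono)
      also note mq
      finally have "real (m - a) * q / real (a + 1) \<le> 2 * r" by (simp add: r_def)
      moreover have "0 \<le> real (m - a) * q / real (a + 1)" using q by simp
      ultimately have "\<bar>real (m - a) * q / real (a + 1) - r\<bar> \<le> 2 * r" using r by linarith
      then have "\<bar>real (m - a) * q / real (a + 1) - r\<bar>\<^sup>2 \<le> (2 * r)\<^sup>2" by (intro power_mono) auto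
      then show "(real (m - a) * q / real (a + 1) - y / x)\<^sup>2 \<le> 4 * r\<^sup>2"
        by (simp add: r_def[symmetric] power_mult_distrib del: of_nat_add)
    qed (use xy s in auto)
    then have W: "W \<le> 4 * r\<^sup>2" by (simp add: const)
    have "U + W \<le> 6 * (r + r\<^sup>2)" using U W r zero_le_power2[of r] by (simp only: distrib_left)
    then have "x * (U + W) \<le> x * (6 * (r + r\<^sup>2))" using xy by (intro mult_left_mono) auto
    moreover have "min x (1 / real (m + 1)) = x" using xn by (simp add: n_def)
    ultimately show ?thesis unfolding risk r_def by (simp add: mult_ac)
  next
    case False
    then have nx: "n * x \<ge> 1" by simp
    have xn: "1 / n \<le> x" using nx n by (simp add: field_simps)
    have U: "x * U \<le> 2 * r / n"
    proof -
      have "U \<le> q * (2 * binsum m x s (\<lambda>a. real (m - a) / (real (a + 1) * real (a + 2))))"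
        unfolding U_def binsum_cmult[symmetric]
      proof (rule binsum_mono)
        fix a
        have "real (m - a) * q * (1 - q) / (real (a + 1))\<^sup>2 = (real (m - a) * q * (1 - q)) * (1 / (real (a + 1))\<^sup>2)"
          by simp
        also have "\<dots> \<le> (real (m - a) * q * 1) * (2 * (1 / (real (a + 1) * real (a + 2))))"
          using q by (intro mult_mono mult_left_mono inverse_square_le) auto
        finally show "real (m - a) * q * (1 - q) / (real (a + 1))\<^sup>2 \<le>
           q * (2 * (real (m - a) / (real (a + 1) * real (a + 2))))" by (simp add: mult_ac)
      qed (use xy s in auto)
      also have "binsum m x s (\<lambda>a. real (m - a) / (real (a + 1) * real (a + 2))) =
        s / (n * x\<^sup>2) * (1 - s ^ (m + 1) - n * x * s ^ m)"
        unfolding n_def using xy by (intro binsum_remaining_inverse_pair) (auto simp: s_def)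
      also have "\<dots> \<le> s / (n * x\<^sup>2) * 1"
      proof -
        have "0 \<le> s ^ (m + 1)" "0 \<le> n * x * s ^ m" using s n xy by auto
        then have "1 - s ^ (m + 1) - n * x * s ^ m \<le> 1" by linarith
        then show ?thesis using s n by (intro mult_left_mono) auto
      qed
      finally have "U \<le> q * (2 * (s / (n * x\<^sup>2)))" using q by (simp add: mult_left_mono)
      then have "x * U \<le> x * (q * (2 * (s / (n * x\<^sup>2))))" using xy by (intro mult_left_mono) auto
      also have "\<dots> = 2 * r / n" using xy n by (simp add: r_def ys power2_eq_square field_simps)
      finally show ?thesis .
    qed
    have W: "x * W \<le> (4 * r + 6 * r\<^sup>2) / n"
    proof -
      \<comment> \<open>This centre makes the numerator of the bias equal to
        \<open>c - (a + 2)\<close>. It differs only by \<open>s\<close> from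
        \<open>(m + 2) * x\<close>, the mean of the count over the \<open>m + 2\<close> trials which
        the size-bias bound produces.\<close>
      define c where "c = n * x + 1"
      have "W \<le> binsum m x s (\<lambda>a. 2 * q\<^sup>2 / x\<^sup>2 * ((real (a + 2) - c)\<^sup>2 / (real (a + 1) * real (a + 2))))"
        unfolding W_def
      proof (rule binsum_mono)
        fix a assume a: "a \<le> m"
        have "real (m - a) * q / real (a + 1) - y / x = q / x * (real (m - a) * x - s * real (a + 1)) / real (a + 1)"
          using xy by (simp add: ys field_simps)
        also have "real (m - a) * x - s * real (a + 1) = c - real (a + 2)"
          using a by (simp add: c_def n_def s_def of_nat_diff algebra_simps)
        finally have "(real (m - a) * q / real (a + 1) - y / x)\<^sup>2 =
           q\<^sup>2 / x\<^sup>2 * (real (a + 2) - c)\<^sup>2 * (1 / (real (a + 1))\<^sup>2)"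
          by (simp add: power_mult_distrib power_divide power2_commute[of c] del: of_nat_add)
        also have "\<dots> \<le> q\<^sup>2 / x\<^sup>2 * (real (a + 2) - c)\<^sup>2 * (2 * (1 / (real (a + 1) * real (a + 2))))"
          by (intro mult_left_mono inverse_square_le) auto
        finally show "(real (m - a) * q / real (a + 1) - y / x)\<^sup>2 \<le>
          2 * q\<^sup>2 / x\<^sup>2 * ((real (a + 2) - c)\<^sup>2 / (real (a + 1) * real (a + 2)))" by (simp add: mult_ac)
      qed (use xy s in auto)
      also have "\<dots> = 2 * q\<^sup>2 / x\<^sup>2 * binsum m x s (\<lambda>a. (real (a + 2) - c)\<^sup>2 / (real (a + 1) * real (a + 2)))"
        by (rule binsum_cmult)
      also have "\<dots> \<le> 2 * q\<^sup>2 / x\<^sup>2 * (binsum (m + 2) x s (\<lambda>a. (real a - c)\<^sup>2) / (real (m + 1) * real (m + 2) * x\<^sup>2))"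
        using binsum_inverse_pair_le[of x s "\<lambda>a. (real a - c)\<^sup>2" m] xy s
        by (intro mult_left_mono) auto
      also have "binsum (m + 2) x s (\<lambda>a. (real a - c)\<^sup>2) = (n + 1) * x * s + s\<^sup>2"
      proof -
        have "real (m + 2) * x - c = - s" by (simp add: c_def n_def s_def algebra_simps)
        then show ?thesis by (subst binsum_square) (simp_all add: s_def n_def power2_commute[of x 1])
      qed
      also have "real (m + 1) * real (m + 2) = n * (n + 1)" by (simp add: n_def)
      finally have "x * W \<le> x * (2 * q\<^sup>2 / x\<^sup>2 * (((n + 1) * x * s + s\<^sup>2) / (n * (n + 1) * x\<^sup>2)))"
        using xy by (intro mult_left_mono) auto
      also have "\<dots> = 2 * q * (q * s) / (n * x\<^sup>2) + 2 * (q * s)\<^sup>2 / (n * ((n + 1) * x) * x\<^sup>2)"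
      proof -
        have "x * (2 * q\<^sup>2 / x\<^sup>2 * ((k * x * s + s\<^sup>2) / (n * k * x\<^sup>2))) =
            2 * q * (q * s) / (n * x\<^sup>2) + 2 * (q * s)\<^sup>2 / (n * (k * x) * x\<^sup>2)" if "k > 0" for k
          using xy(1) n that by (simp add: field_simps power2_eq_square)
        then show ?thesis using n by simp
      qed
      also have "\<dots> = 2 * (q * r / x) / n + 2 * r\<^sup>2 / n * (1 / ((n + 1) * x))"
        unfolding ys[symmetric] using xy(1) n by (simp add: yx power2_eq_square)
      also have "\<dots> \<le> 2 * (2 * r\<^sup>2 + 2 * r) / n + 2 * r\<^sup>2 / n * 1"
      proof (intro add_mono mult_left_mono divide_right_mono)
        \<comment> \<open>The summand \<open>2 * r\<^sup>2\<close> covers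
          \<open>x \<le> 1/2\<close>, where \<open>q \<le> 2 * y\<close>; the summand
          \<open>2 * r\<close> covers larger \<open>x\<close>, where \<open>q \<le> 1\<close>
          suffices.\<close>
        show "q * r / x \<le> 2 * r\<^sup>2 + 2 * r"
        proof (cases "x \<le> 1/2")
          case True
          have "q * r / x \<le> 2 * y * r / x"
            using qle[OF True] r xy by (intro divide_right_mono mult_right_mono) auto
          also have "\<dots> = 2 * r\<^sup>2" using xy by (simp add: yx power2_eq_square)
          finally show ?thesis using r by simp
        next
          case False
          have "q * r / x \<le> 1 * r / (1/2)"
            using False q r by (intro frac_le mult_right_mono) auto
          also have "\<dots> \<le> 2 * r\<^sup>2 + 2 * r" by simp
          finally show ?thesis .
        qed
        have "1 \<le> (n + 1) * x" using nx xy by (simp add: distrib_right)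
        then show "1 / ((n + 1) * x) \<le> 1" by simp
      qed (use n in auto)
      finally show ?thesis by (simp add: add_divide_distrib[symmetric] add.commute)
    qed
    have "x * (U + W) \<le> 2 * r / n + (4 * r + 6 * r\<^sup>2) / n" using U W by (simp add: distrib_left)
    also have "\<dots> = 6 * (r + r\<^sup>2) * (1 / n)" by (simp add: add_divide_distrib[symmetric])
    finally show ?thesis using xn by (simp add: risk r_def n_def)
  qed
qed

section \<open>Poisson probabilities\<close>

lemma pmf_poi: "0 \<le> t \<Longrightarrow> pmf (poi t) y = t ^ y / fact y * exp (- t)"
  by (cases "t = 0") (auto simp: poi_def power_0_left)

lemma borel_measurable_pmf_poi [measurable]: "(\<lambda>t. pmf (poi t) y) \<in> borel_measurable borel"
proof -
  have "(\<lambda>t. pmf (poi t) y) = (\<lambda>t. if t > 0 then t ^ y / fact y * exp (- t) else pmf (return_pmf 0) y)"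
    by (auto simp: poi_def)
  then show ?thesis by simp
qed

text \<open>The identity behind the Robbins estimator: in integrals over the prior a factor
  \<open>t\<close> becomes a shift of the observation.\<close>

lemma pmf_poi_Suc: "0 \<le> t \<Longrightarrow> real (y + 1) * pmf (poi t) (y + 1) = t * pmf (poi t) y"
  by (simp add: pmf_poi divide_simps)

lemma power_div_fact_le_exp: "0 \<le> (x::real) \<Longrightarrow> x ^ n / fact n \<le> exp x"
proof -
  assume x: "0 \<le> x"
  have "(\<lambda>n. x ^ n / fact n) sums exp x"
    using exp_converges[of x] by (simp add: divide_inverse mult.commute)
  moreover from this have "x ^ n / fact n \<le> (\<Sum>n. x ^ n / fact n)"
    using sum_le_suminf[of "\<lambda>n. x ^ n / fact n" "{n}"] x by (simp add: sums_iff)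
  ultimately show ?thesis by (simp add: sums_iff)
qed

text \<open>Half of the exponential decay pays for the power:
  \<open>(t / 2) ^ y / fact y \<le> exp (t / 2)\<close>.\<close>

lemma pmf_poi_le_exp:
  assumes "0 \<le> t" shows "pmf (poi t) y \<le> 2 ^ y * exp (- t / 2)"
proof -
  have "pmf (poi t) y = 2 ^ y * ((t / 2) ^ y / fact y) * exp (- t)"
    by (simp add: pmf_poi assms power_divide)
  also have "\<dots> \<le> 2 ^ y * exp (t / 2) * exp (- t)"
    using assms by (intro mult_right_mono mult_left_mono power_div_fact_le_exp) auto
  also have "\<dots> = 2 ^ y * exp (- t / 2)" by (simp add: mult.assoc exp_add[symmetric])
  finally show ?thesis .
qed

text \<open>The series of \<open>exp\<close> at \<open>y\<close> gives
  \<open>y ^ y / fact y \<le> exp y\<close>, and \<open>exp 1 / 4 \<le> 3 / 4\<close>.\<close>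

lemma pmf_poi_le_power:
  assumes "0 \<le> t" "4 * t \<le> real y" shows "pmf (poi t) y \<le> (3 / 4) ^ y"
proof -
  have "pmf (poi t) y \<le> t ^ y / fact y"
    using assms mult_left_le[of "exp (- t)" "t ^ y / fact y"] by (simp add: pmf_poi)
  also have "\<dots> \<le> (real y / 4) ^ y / fact y"
    using assms by (intro divide_right_mono power_mono) auto
  also have "\<dots> = (1 / 4) ^ y * (real y ^ y / fact y)" by (simp add: power_divide)
  also have "\<dots> \<le> (1 / 4) ^ y * exp (real y)"
    by (intro mult_left_mono power_div_fact_le_exp) auto
  also have "\<dots> = (1 / 4) ^ y * exp 1 ^ y" by (simp add: exp_of_nat_mult[symmetric])
  also have "\<dots> \<le> (1 / 4) ^ y * 3 ^ y" by (intro mult_left_mono power_mono exp_le) auto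
  also have "\<dots> = (3 / 4) ^ y" by (simp add: power_mult_distrib[symmetric])
  finally show ?thesis .
qed

lemma sums_pmf_poi: "0 \<le> t \<Longrightarrow> pmf (poi t) sums 1"
proof -
  assume t: "0 \<le> t"
  have "(\<lambda>n. t ^ n / fact n * exp (- t)) sums (exp t * exp (- t))"
    using exp_converges[of t] by (intro sums_mult2) (simp add: divide_inverse mult.commute)
  also have "(\<lambda>n. t ^ n / fact n * exp (- t)) = pmf (poi t)"
    using t by (simp add: pmf_poi fun_eq_iff)
  finally show ?thesis by (simp add: exp_minus)
qed

text \<open>The Poisson variance, from the first two factorial moments; each of these is obtained by
  shifting the previous series with \<open>pmf_poi_Suc\<close>.\<close>

lemma sums_poi_square:
  assumes "0 \<le> t" shows "(\<lambda>y. (real y - t)\<^sup>2 * pmf (poi t) y) sums t"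
proof -
  let ?p = "pmf (poi t)"
  have p: "?p sums 1" by (rule sums_pmf_poi[OF assms])
  have 1: "(\<lambda>y. real y * ?p y) sums t"
  proof -
    have "(\<lambda>y. t * ?p y) sums (t * 1)" by (rule sums_mult[OF p])
    then have "(\<lambda>y. real (Suc y) * ?p (Suc y)) sums t"
      using pmf_poi_Suc[OF assms] by simp
    then show ?thesis by (subst (asm) sums_Suc_iff) simp
  qed
  have 2: "(\<lambda>y. real y * (real y - 1) * ?p y) sums t\<^sup>2"
  proof -
    have "(\<lambda>y. t * (real y * ?p y)) sums (t * t)" by (rule sums_mult[OF 1])
    also have "(\<lambda>y. t * (real y * ?p y)) = (\<lambda>y. real (Suc y) * (real (Suc y) - 1) * ?p (Suc y))"
    proof
      fix y show "t * (real y * ?p y) = real (Suc y) * (real (Suc y) - 1) * ?p (Suc y)"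
      proof -
        have "t * (real y * ?p y) = real y * (t * ?p y)" by (simp only: mult.left_commute)
        also have "\<dots> = real y * (real (y + 1) * ?p (y + 1))" by (simp only: pmf_poi_Suc[OF assms])
        finally show ?thesis by simp
      qed
    qed
    finally show ?thesis by (subst (asm) sums_Suc_iff) (simp add: power2_eq_square)
  qed
  have "(\<lambda>y. real y * (real y - 1) * ?p y + (1 - 2 * t) * (real y * ?p y) + t\<^sup>2 * ?p y)
      sums (t\<^sup>2 + (1 - 2 * t) * t + t\<^sup>2 * 1)"
    by (intro sums_add sums_mult 1 2 p)
  then show ?thesis by (simp add: power2_eq_square algebra_simps)
qed

lemma suminf_poi_square:
  assumes "0 \<le> t" shows "(\<Sum>y. ennreal ((real y - t)\<^sup>2 * pmf (poi t) y)) = ennreal t"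
  using sums_poi_square[OF assms] by (subst suminf_ennreal2) (auto simp: sums_iff)

text \<open>If \<open>k \<le> 4 * t\<close>, the full variance \<open>t\<close> is at most
  \<open>t powr p * (k / 4) powr (- (p - 1))\<close>. If \<open>t\<close> is smaller, every
  \<open>y > k\<close> exceeds \<open>4 * t\<close> and the mass at \<open>y\<close> decays
  geometrically.\<close>

lemma poi_square_tail_le:
  fixes p :: real
  assumes "p > 1"
  obtains C where "C > 0" "\<And>t k. 0 \<le> t \<Longrightarrow> 1 \<le> k \<Longrightarrow>
     (\<Sum>y. ennreal (if y > k then (real y - t)\<^sup>2 * pmf (poi t) y else 0))
       \<le> ennreal (C * real k powr (- (p - 1)) * (1 + t powr p))"
proof -
  \<comment> \<open>The exponent is 2 from the squared error plus \<open>p - 1\<close>, which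
    compensates the factor \<open>y powr (- (p - 1))\<close> extracted to produce the power of
    \<open>k\<close>.\<close>
  define a where "a y = real y powr (p + 1) * (3 / 4) ^ y" for y
  have "a \<in> O(\<lambda>n. (4 / 5) ^ n)" unfolding a_def by real_asymp
  then have a: "summable a"
    by (rule summable_comparison_test_bigo[rotated]) (simp add: summable_geometric)
  define S where "S = suminf a"
  have a0: "0 \<le> a y" for y by (simp add: a_def)
  have S: "S \<ge> 0" unfolding S_def by (intro suminf_nonneg a a0)
  define C where "C = S + 4 powr (p - 1)"
  show thesis
  proof (rule that)
    show "C > 0" using S by (simp add: C_def add_nonneg_pos)
    fix t :: real and k :: nat assume t: "0 \<le> t" and k: "1 \<le> k"
    let ?u = "\<lambda>y. if y > k then (real y - t)\<^sup>2 * pmf (poi t) y else 0"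
    show "(\<Sum>y. ennreal (?u y)) \<le> ennreal (C * real k powr (- (p - 1)) * (1 + t powr p))"
    proof (cases "real k \<le> 4 * t")
      case True
      have "(\<Sum>y. ennreal (?u y)) \<le> (\<Sum>y. ennreal ((real y - t)\<^sup>2 * pmf (poi t) y))"
        by (intro suminf_le allI) (auto intro: ennreal_leI)
      also have "\<dots> = ennreal t" by (rule suminf_poi_square[OF t])
      also have "\<dots> \<le> ennreal (C * real k powr (- (p - 1)) * (1 + t powr p))"
      proof (rule ennreal_leI)
        have t0: "t > 0" using True k by auto
        have "t = t powr p * t powr (- (p - 1))" using t0 by (simp add: powr_add[symmetric])
        also have "\<dots> \<le> t powr p * (real k / 4) powr (- (p - 1))"
          using True k assms by (intro mult_left_mono powr_mono2') auto
        also have "(real k / 4) powr (- (p - 1)) = 4 powr (p - 1) * real k powr (- (p - 1))"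
          unfolding powr_divide powr_minus_divide by simp
        also have "t powr p * (4 powr (p - 1) * real k powr (- (p - 1))) \<le> (1 + t powr p) * (C * real k powr (- (p - 1)))"
          using S by (intro mult_mono) (auto simp: C_def)
        finally show "t \<le> C * real k powr (- (p - 1)) * (1 + t powr p)" by (simp add: mult_ac)
      qed
      finally show ?thesis .
    next
      case False
      have "?u y \<le> real k powr (- (p - 1)) * a y" for y
      proof (cases "y > k")
        case True
        have y: "real y > 0" "4 * t \<le> real y" using True False k by auto
        have "(real y - t)\<^sup>2 * pmf (poi t) y \<le> (real y)\<^sup>2 * (3/4) ^ y"
          using t y by (intro mult_mono power_mono pmf_poi_le_power) auto
        also have "(real y)\<^sup>2 = real y powr (- (p - 1)) * real y powr (p + 1)"
          using y powr_add[of "real y" "- (p - 1)" "p + 1"] by simp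
        also have "\<dots> * (3/4) ^ y \<le> real k powr (- (p - 1)) * real y powr (p + 1) * (3/4) ^ y"
          using True k assms by (intro mult_right_mono powr_mono2') auto
        finally show ?thesis using True by (simp add: a_def mult_ac)
      qed (simp add: a0)
      then have "(\<Sum>y. ennreal (?u y)) \<le> (\<Sum>y. ennreal (real k powr (- (p - 1)) * a y))"
        by (intro suminf_le allI ennreal_leI) auto
      also have "\<dots> = ennreal (real k powr (- (p - 1)) * S)"
        using a by (subst suminf_ennreal2) (auto simp: a0 S_def suminf_mult intro: summable_mult)
      also have "\<dots> \<le> ennreal (C * real k powr (- (p - 1)) * (1 + t powr p))"
      proof (rule ennreal_leI)
        have "real k powr (- (p - 1)) * S * 1 \<le> (real k powr (- (p - 1)) * C) * (1 + t powr p)"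
          using S by (intro mult_mono) (auto simp: C_def)
        then show "real k powr (- (p - 1)) * S \<le> C * real k powr (- (p - 1)) * (1 + t powr p)"
          by (simp add: mult_ac)
      qed
      finally show ?thesis .
    qed
  qed
qed

text \<open>Of the decay \<open>exp (- t / 2)\<close>, one half absorbs \<open>2 ^ y\<close> because
  \<open>4 * y \<le> t\<close>. The rest splits into two factors \<open>exp (- t / 8)\<close>: one
  absorbs \<open>t\<^sup>2\<close> with constant \<open>8\<^sup>2 * fact 2 = 128\<close>, the other
  is at most \<open>1 / n\<close>.\<close>

lemma square_poi_le_inverse:
  assumes "n \<ge> 1" "T \<ge> 4 * real y" "T \<ge> 8 * ln (real n)" "t \<ge> T"
  shows "t\<^sup>2 * pmf (poi t) y \<le> 128 / real n"
proof -
  have t: "t \<ge> 0" "4 * real y \<le> t" "8 * ln (real n) \<le> t" using assms by auto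
  have "pmf (poi t) y \<le> 2 ^ y * exp (- t / 2)" by (rule pmf_poi_le_exp[OF t(1)])
  also have "(2::real) ^ y \<le> exp 1 ^ y" using exp_ge_add_one_self[of 1] by (intro power_mono) auto
  also have "\<dots> \<le> exp (t / 4)" using t by (simp add: exp_of_nat_mult[symmetric])
  also have "exp (t / 4) * exp (- t / 2) = exp (- t / 8) * exp (- t / 8)"
    by (simp add: exp_add[symmetric])
  finally have "t\<^sup>2 * pmf (poi t) y \<le> t\<^sup>2 * (exp (- t / 8) * exp (- t / 8))"
    by (simp add: mult_left_mono)
  also have "\<dots> = 128 * ((t / 8)\<^sup>2 / fact 2) * exp (- t / 8) * exp (- t / 8)"
    by (simp add: power_divide fact_numeral)
  also have "\<dots> \<le> 128 * exp (t / 8) * exp (- t / 8) * exp (- t / 8)"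
    using t by (intro mult_right_mono mult_left_mono power_div_fact_le_exp) auto
  also have "\<dots> = 128 * exp (- t / 8)" by (simp add: mult.assoc exp_add[symmetric])
  also have "\<dots> \<le> 128 * exp (- ln (real n))" using t by simp
  also have "\<dots> = 128 / real n" using assms(1) by (simp add: exp_minus inverse_eq_divide)
  finally show ?thesis .
qed

text \<open>With mean \<open>16 * k\<close> the values up to \<open>k\<close> lie so far below the
  mean that they carry at most half of the variance.\<close>

lemma poi_square_tail_ge:
  assumes k: "k \<ge> 1"
  defines "a \<equiv> 16 * real k"
  shows "(\<Sum>y. ennreal (if y > k then (real y - a)\<^sup>2 * pmf (poi a) y else 0)) \<ge> ennreal (a / 2)"
proof -
  have a: "a \<ge> 0" by (simp add: a_def)
  define u where "u y = (real y - a)\<^sup>2 * pmf (poi a) y" for y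
  have u: "u sums a" unfolding u_def by (rule sums_poi_square[OF a])
  have "(\<Sum>y\<le>k. u y) \<le> (\<Sum>y\<le>k. a\<^sup>2 * (2 ^ y * exp (- a / 2)))"
    unfolding u_def
  proof (intro sum_mono mult_mono pmf_poi_le_exp a)
    fix y assume "y \<in> {..k}"
    then have "\<bar>real y - a\<bar> \<le> \<bar>a\<bar>" by (auto simp: a_def)
    then show "(real y - a)\<^sup>2 \<le> a\<^sup>2" by (simp only: abs_le_square_iff)
  qed auto
  also have "\<dots> = a\<^sup>2 * exp (- a / 2) * (2 ^ Suc k - 1)"
  proof -
    have "(\<Sum>y\<le>k. 2 ^ y) = (2::real) ^ Suc k - 1" by (induction k) auto
    then have "a\<^sup>2 * exp (- a / 2) * (2 ^ Suc k - 1) = a\<^sup>2 * exp (- a / 2) * (\<Sum>y\<le>k. 2 ^ y)"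
      by simp
    also have "\<dots> = (\<Sum>y\<le>k. a\<^sup>2 * (2 ^ y * exp (- a / 2)))"
      unfolding sum_distrib_left by (intro sum.cong) auto
    finally show ?thesis by simp
  qed
  also have "\<dots> \<le> a\<^sup>2 * exp (- a / 2) * 2 ^ Suc k" by (intro mult_left_mono) auto
  also have "\<dots> \<le> a / 2"
  proof -
    have "real k \<le> 2 ^ k" using of_nat_less_two_power[of k] by (simp add: less_imp_le)
    \<comment> \<open>After division by \<open>a\<close> the claim is
      \<open>64 * k * 2 ^ k \<le> exp (8 * k)\<close>, and
      \<open>64 * 2 * 2 = 2 ^ 8\<close>.\<close>
    then have "64 * (real k * 2 ^ k) \<le> 64 ^ k * (2 ^ k * 2 ^ k)"
      using k self_le_power[of "64::real" k] by (intro mult_mono) auto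
    also have "\<dots> = (2 ^ 8) ^ k" by (simp add: power_mult_distrib[symmetric])
    also have "\<dots> \<le> (exp 1 ^ 8) ^ k" using exp_ge_add_one_self[of 1] by (intro power_mono) auto
    also have "\<dots> = exp (a / 2)" by (simp add: a_def exp_of_nat_mult[symmetric] power_mult[symmetric])
    finally have "a * 64 * (real k * 2 ^ k) \<le> a * exp (a / 2)"
      using a by (simp add: mult.assoc mult_left_mono)
    then have "a * 64 * (real k * 2 ^ k) * exp (- a / 2) \<le> a * exp (a / 2) * exp (- a / 2)"
      by (intro mult_right_mono) auto
    also have "\<dots> = a" by (simp add: mult.assoc exp_add[symmetric])
    finally show ?thesis by (simp add: a_def power2_eq_square)
  qed
  finally have le: "(\<Sum>y\<le>k. u y) \<le> a / 2" .
  have "(\<lambda>y. u y - (if y \<in> {..k} then u y else 0)) sums (a - (\<Sum>y\<le>k. u y))"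
    by (intro sums_diff u sums_If_finite_set) auto
  also have "(\<lambda>y. u y - (if y \<in> {..k} then u y else 0)) = (\<lambda>y. if y > k then u y else 0)"
    by (auto simp: fun_eq_iff)
  finally have v: "(\<lambda>y. if y > k then u y else 0) sums (a - (\<Sum>y\<le>k. u y))" .
  then have "(\<Sum>y. ennreal (if y > k then u y else 0)) = ennreal (a - (\<Sum>y\<le>k. u y))"
    by (subst suminf_ennreal2) (auto simp: sums_iff u_def)
  then show ?thesis using le unfolding u_def by (simp add: ennreal_leI)
qed

section \<open>The Bayes problem for a fixed prior\<close>

text \<open>The finite mean makes \<theta> integrable, so that its conditional expectation is
  characterized by its integrals, and it makes the mmse finite.\<close>

locale prior = prob_space G for G :: "real measure" +
  assumes sets_prior [measurable_cong]: "sets G = sets borel"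
    and nonneg: "AE u in G. 0 \<le> u"
    and mean_finite: "(\<integral>\<^sup>+ u. ennreal u \<partial>G) < \<infinity>"
begin

definition marg :: "nat \<Rightarrow> real" where
  "marg y = (\<integral>t. pmf (poi t) y \<partial>G)"

text \<open>Robbins' formula for the posterior mean. At observations of marginal probability zero,
  division by zero makes it 0.\<close>

definition bayes :: "nat \<Rightarrow> real" where
  "bayes y = real (y + 1) * marg (y + 1) / marg y"

text \<open>The posterior variance at \<open>y\<close>, weighted by the marginal probability of
  \<open>y\<close>; the sum over \<open>y\<close> is the mmse.\<close>

definition bayes_risk :: "nat \<Rightarrow> real" where
  "bayes_risk y = (\<integral>t. (bayes y - t)\<^sup>2 * pmf (poi t) y \<partial>G)"

section \<open>Marginal probabilities and weighted posterior moments\<close>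

lemma space_prior [simp]: "space G = UNIV"
  using sets_eq_imp_space_eq[OF sets_prior] by simp

lemma integrable_pmf [simp]: "integrable G (\<lambda>t. pmf (poi t) y)"
  by (rule integrable_const_bound[where B = 1]) (auto simp: pmf_le_1)

lemma marg_nonneg [simp]: "0 \<le> marg y"
  by (simp add: marg_def)

lemma bayes_nonneg [simp]: "0 \<le> bayes y"
  by (simp add: bayes_def)

lemma nn_integral_pmf: "(\<integral>\<^sup>+t. ennreal (pmf (poi t) y) \<partial>G) = ennreal (marg y)"
  unfolding marg_def by (rule nn_integral_eq_integral) auto

lemma marg_pair_le: "y \<noteq> z \<Longrightarrow> marg y + marg z \<le> 1"
proof -
  assume yz: "y \<noteq> z"
  have "marg y + marg z = (\<integral>t. pmf (poi t) y + pmf (poi t) z \<partial>G)"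
    by (simp add: marg_def)
  also have "\<dots> \<le> (\<integral>t. 1 \<partial>G)"
  proof (rule integral_mono)
    fix t
    have "pmf (poi t) y + pmf (poi t) z = measure (measure_pmf (poi t)) {y, z}"
      using yz by (simp add: measure_measure_pmf_finite)
    then show "pmf (poi t) y + pmf (poi t) z \<le> 1" by simp
  qed auto
  finally show ?thesis using prob_space by simp
qed

lemma first_moment:
  shows integrable_first: "integrable G (\<lambda>t. t * pmf (poi t) y)"
    and integral_first: "(\<integral>t. t * pmf (poi t) y \<partial>G) = real (y + 1) * marg (y + 1)"
proof -
  have eq: "AE t in G. t * pmf (poi t) y = real (y + 1) * pmf (poi t) (y + 1)"
    using nonneg by eventually_elim (simp only: pmf_poi_Suc)
  show "integrable G (\<lambda>t. t * pmf (poi t) y)"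
    by (subst integrable_cong_AE[OF _ _ eq]) auto
  show "(\<integral>t. t * pmf (poi t) y \<partial>G) = real (y + 1) * marg (y + 1)"
    unfolding marg_def by (subst integral_cong_AE[OF _ _ eq]) auto
qed

lemma integrable_second: "integrable G (\<lambda>t. t\<^sup>2 * pmf (poi t) y)"
proof -
  have eq: "AE t in G. t\<^sup>2 * pmf (poi t) y = real (y + 1) * (t * pmf (poi t) (y + 1))"
    using nonneg
  proof eventually_elim
    case (elim t)
    then show ?case
      using pmf_poi_Suc[of t y] by (simp add: power2_eq_square mult.assoc mult.left_commute del: of_nat_add)
  qed
  show ?thesis
    by (subst integrable_cong_AE[OF _ _ eq]) (auto intro: integrable_first)
qed

text \<open>A zero of the marginal forces the Poisson mass to vanish almost everywhere, and then its
  product with \<open>t\<close> as well. Hence \<open>bayes_marg\<close> holds also where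
  \<open>bayes\<close> has its default value.\<close>

lemma marg_Suc_eq_0: "marg y = 0 \<Longrightarrow> marg (y + 1) = 0"
proof -
  assume "marg y = 0"
  then have "AE t in G. pmf (poi t) y = 0"
    unfolding marg_def by (subst (asm) integral_nonneg_eq_0_iff_AE) auto
  then have "AE t in G. t * pmf (poi t) y = 0" by eventually_elim simp
  then have "(\<integral>t. t * pmf (poi t) y \<partial>G) = 0" by (rule integral_eq_zero_AE)
  then show ?thesis unfolding integral_first by simp
qed

lemma bayes_marg: "bayes y * marg y = real (y + 1) * marg (y + 1)"
  using marg_Suc_eq_0[of y] by (cases "marg y = 0") (auto simp: bayes_def)

lemma integral_square:
  shows integrable_square: "integrable G (\<lambda>t. (c - t)\<^sup>2 * pmf (poi t) y)"
    and integral_square_eq: "(\<integral>t. (c - t)\<^sup>2 * pmf (poi t) y \<partial>G) =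
      c\<^sup>2 * marg y - 2 * c * (bayes y * marg y) + (\<integral>t. t\<^sup>2 * pmf (poi t) y \<partial>G)"
proof -
  have eq: "(\<lambda>t. (c - t)\<^sup>2 * pmf (poi t) y) =
    (\<lambda>t. c\<^sup>2 * pmf (poi t) y - 2 * c * (t * pmf (poi t) y) + t\<^sup>2 * pmf (poi t) y)"
    by (simp add: fun_eq_iff power2_eq_square algebra_simps)
  show "integrable G (\<lambda>t. (c - t)\<^sup>2 * pmf (poi t) y)"
    unfolding eq by (intro Bochner_Integration.integrable_add Bochner_Integration.integrable_diff integrable_mult_right integrable_second integrable_first integrable_pmf)
  show "(\<integral>t. (c - t)\<^sup>2 * pmf (poi t) y \<partial>G) =
      c\<^sup>2 * marg y - 2 * c * (bayes y * marg y) + (\<integral>t. t\<^sup>2 * pmf (poi t) y \<partial>G)"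
    unfolding eq using integrable_first integrable_second
    by (simp add: integral_first bayes_marg marg_def[symmetric] del: of_nat_add)
qed

lemma bayes_risk_nonneg [simp]: "0 \<le> bayes_risk y"
  by (simp add: bayes_risk_def)

text \<open>The orthogonal decomposition around the posterior mean: \<open>bayes_marg\<close>
  cancels the cross term.\<close>

lemma nn_integral_square:
  "(\<integral>\<^sup>+t. ennreal ((c - t)\<^sup>2 * pmf (poi t) y) \<partial>G) =
     ennreal (marg y * (c - bayes y)\<^sup>2) + ennreal (bayes_risk y)"
proof -
  have "(\<integral>\<^sup>+t. ennreal ((c - t)\<^sup>2 * pmf (poi t) y) \<partial>G) = ennreal (\<integral>t. (c - t)\<^sup>2 * pmf (poi t) y \<partial>G)"
    by (intro nn_integral_eq_integral integrable_square) auto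
  also have "(\<integral>t. (c - t)\<^sup>2 * pmf (poi t) y \<partial>G) = marg y * (c - bayes y)\<^sup>2 + bayes_risk y"
    unfolding bayes_risk_def integral_square_eq by (simp add: power2_eq_square algebra_simps)
  finally show ?thesis by simp
qed

text \<open>Jensen's inequality for the posterior, in the form that the posterior variance is
  nonnegative.\<close>

lemma bayes_square_le: "(bayes y)\<^sup>2 * marg y \<le> (\<integral>t. t\<^sup>2 * pmf (poi t) y \<partial>G)"
  using bayes_risk_nonneg[of y] unfolding bayes_risk_def integral_square_eq
  by (simp add: power2_eq_square)

section \<open>The joint law of parameter and observation, and the posterior mean\<close>

lemma sets_joint [measurable_cong]: "sets (joint_law G) = sets (borel \<Otimes>\<^sub>M count_space UNIV)"
  unfolding joint_law_def by (simp add: sets_pair_measure_cong[OF sets_prior refl])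

lemma space_joint [simp]: "space (joint_law G) = UNIV"
  by (simp add: joint_law_def space_pair_measure)

lemma borel_measurable_kernel [measurable]:
  "(\<lambda>(t, y). ennreal (pmf (poi t) y)) \<in> borel_measurable (borel \<Otimes>\<^sub>M count_space UNIV)"
proof -
  have "(\<lambda>x. (\<lambda>y x. ennreal (pmf (poi (fst x)) y)) (snd x) x) \<in> borel_measurable (borel \<Otimes>\<^sub>M count_space UNIV)"
    by (rule measurable_compose_countable) auto
  then show ?thesis by (simp add: case_prod_beta')
qed

lemma nn_integral_joint:
  assumes [measurable]: "\<phi> \<in> borel_measurable (borel \<Otimes>\<^sub>M count_space UNIV)"
  shows "(\<integral>\<^sup>+x. \<phi> x \<partial>joint_law G) = (\<Sum>y. \<integral>\<^sup>+t. ennreal (pmf (poi t) y) * \<phi> (t, y) \<partial>G)"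
proof -
  interpret C: sigma_finite_measure "count_space (UNIV :: nat set)"
    by (rule sigma_finite_measure_count_space)
  interpret P: pair_sigma_finite G "count_space (UNIV :: nat set)" ..
  have "(\<integral>\<^sup>+x. \<phi> x \<partial>joint_law G) =
      (\<integral>\<^sup>+x. (case x of (t, y) \<Rightarrow> ennreal (pmf (poi t) y)) * \<phi> x \<partial>(G \<Otimes>\<^sub>M count_space UNIV))"
    unfolding joint_law_def by (rule nn_integral_density) auto
  also have "\<dots> = (\<integral>\<^sup>+y. \<integral>\<^sup>+t. ennreal (pmf (poi t) y) * \<phi> (t, y) \<partial>G \<partial>count_space UNIV)"
    by (subst P.nn_integral_snd[symmetric]) auto
  also have "\<dots> = (\<Sum>y. \<integral>\<^sup>+t. ennreal (pmf (poi t) y) * \<phi> (t, y) \<partial>G)"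
    by (rule nn_integral_count_space_nat)
  finally show ?thesis .
qed

lemma nn_integral_joint_snd:
  "(\<integral>\<^sup>+x. g (snd x) \<partial>joint_law G) = (\<Sum>y. ennreal (marg y) * g y)"
  by (subst nn_integral_joint) (simp_all add: nn_integral_multc nn_integral_pmf)

lemma suminf_nn_integral_poi:
  assumes "\<And>t. 0 \<le> t \<Longrightarrow> (\<Sum>y. ennreal (\<psi> t y)) = \<Psi> t" "\<And>y. (\<lambda>t. \<psi> t y) \<in> borel_measurable borel"
  shows "(\<Sum>y. \<integral>\<^sup>+t. ennreal (\<psi> t y) \<partial>G) = (\<integral>\<^sup>+t. \<Psi> t \<partial>G)"
proof -
  have [measurable]: "(\<lambda>t. \<psi> t y) \<in> borel_measurable G" for y using assms(2) by measurable
  have "(\<Sum>y. \<integral>\<^sup>+t. ennreal (\<psi> t y) \<partial>G) = (\<integral>\<^sup>+t. (\<Sum>y. ennreal (\<psi> t y)) \<partial>G)"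
    by (rule nn_integral_suminf[symmetric]) auto
  also have "\<dots> = (\<integral>\<^sup>+t. \<Psi> t \<partial>G)"
    using nonneg by (intro nn_integral_cong_AE) (auto simp: assms(1))
  finally show ?thesis .
qed

lemma suminf_marg: "(\<Sum>y. ennreal (marg y)) = 1"
proof -
  have "(\<Sum>y. \<integral>\<^sup>+t. ennreal (pmf (poi t) y) \<partial>G) = (\<integral>\<^sup>+t. 1 \<partial>G)"
    using sums_pmf_poi by (intro suminf_nn_integral_poi) (auto simp: suminf_ennreal2 sums_iff)
  then show ?thesis using emeasure_space_1 by (simp add: nn_integral_pmf)
qed

lemma sums_marg: "marg sums 1"
proof -
  have "summable marg" by (rule summable_suminf_not_top) (auto simp: suminf_marg)
  moreover from this have "ennreal (suminf marg) = 1"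
    using suminf_marg by (simp add: suminf_ennreal2)
  ultimately show ?thesis by (simp add: sums_iff suminf_nonneg)
qed

lemma prob_space_joint: "prob_space (joint_law G)"
proof
  have "emeasure (joint_law G) (space (joint_law G)) = (\<integral>\<^sup>+x. 1 \<partial>joint_law G)" by simp
  also have "\<dots> = 1" using nn_integral_joint_snd[of "\<lambda>_. 1"] suminf_marg by simp
  finally show "emeasure (joint_law G) (space (joint_law G)) = 1" .
qed

lemma AE_joint_nonneg: "AE x in joint_law G. 0 \<le> fst x"
proof -
  have "(\<integral>\<^sup>+x. indicator {x. fst x < 0} x \<partial>joint_law G) =
     (\<Sum>y. \<integral>\<^sup>+t. ennreal (pmf (poi t) y) * indicator {x. fst x < 0} (t, y) \<partial>G)"
    by (subst nn_integral_joint) auto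
  also have "\<dots> = (\<Sum>y. \<integral>\<^sup>+t. 0 \<partial>G)"
    using nonneg by (intro suminf_cong nn_integral_cong_AE) auto
  finally have "(\<integral>\<^sup>+x. indicator {x. fst x < 0} x \<partial>joint_law G) = 0" by simp
  moreover have "{x \<in> space (joint_law G). fst x < 0} \<in> sets (joint_law G)" by measurable
  then have "{x. fst x < 0} \<in> sets (joint_law G)" by simp
  ultimately show ?thesis by (intro AE_I[of _ _ "{x. fst x < 0}"]) auto
qed

text \<open>Events of the sub-sigma-algebra are preimages of sets \<open>B\<close> of observations.
  The integrals of \<theta> and of \<open>bayes\<close> over such an event are both the sum of
  \<open>bayes y * marg y\<close> over \<open>y\<close> in \<open>B\<close>, which characterizes the
  conditional expectation.\<close>

lemma AE_posterior_mean: "AE x in joint_law G. posterior_mean G x = bayes (snd x)"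
proof -
  let ?J = "joint_law G"
  let ?F = "vimage_algebra (space ?J) snd (count_space UNIV) :: (real \<times> nat) measure"
  interpret J: prob_space ?J by (rule prob_space_joint)
  have sub: "subalgebra ?J ?F"
  proof -
    have "snd \<in> measurable ?J (count_space UNIV)" by measurable
    from measurable_sets[OF this] show ?thesis
      unfolding subalgebra_def by (auto simp: sets_vimage_algebra2)
  qed
  interpret F: finite_measure_subalgebra ?J ?F by standard (rule sub)
  have theta: "(\<integral>\<^sup>+x. ennreal (indicator B (snd x) * fst x) \<partial>?J) = (\<Sum>y. ennreal (indicator B y * (bayes y * marg y)))" for B
  proof -
    have "(\<integral>\<^sup>+x. ennreal (indicator B (snd x) * fst x) \<partial>?J) =
      (\<Sum>y. \<integral>\<^sup>+t. ennreal (pmf (poi t) y) * ennreal (indicator B y * t) \<partial>G)"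
      by (subst nn_integral_joint) auto
    also have "\<dots> = (\<Sum>y. ennreal (indicator B y * (bayes y * marg y)))"
    proof (rule suminf_cong)
      fix y
      have "(\<integral>\<^sup>+t. ennreal (pmf (poi t) y) * ennreal (indicator B y * t) \<partial>G) =
        (\<integral>\<^sup>+t. ennreal (indicator B y * (t * pmf (poi t) y)) \<partial>G)"
        by (intro nn_integral_cong) (simp add: ennreal_mult'[symmetric] mult_ac)
      also have "\<dots> = ennreal (\<integral>t. indicator B y * (t * pmf (poi t) y) \<partial>G)"
        using nonneg by (intro nn_integral_eq_integral integrable_mult_right integrable_first) auto
      also have "(\<integral>t. indicator B y * (t * pmf (poi t) y) \<partial>G) = indicator B y * (bayes y * marg y)"
        by (simp only: integral_mult_right_zero integral_first bayes_marg)
      finally show "(\<integral>\<^sup>+t. ennreal (pmf (poi t) y) * ennreal (indicator B y * t) \<partial>G) =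
        ennreal (indicator B y * (bayes y * marg y))" .
    qed
    finally show ?thesis .
  qed
  have est: "(\<integral>\<^sup>+x. ennreal (indicator B (snd x) * bayes (snd x)) \<partial>?J) = (\<Sum>y. ennreal (indicator B y * (bayes y * marg y)))" for B
    by (subst nn_integral_joint_snd) (simp add: ennreal_mult'[symmetric] mult_ac)
  have fin: "(\<integral>\<^sup>+x. ennreal (fst x) \<partial>?J) < \<infinity>"
  proof -
    have "(\<integral>\<^sup>+x. ennreal (fst x) \<partial>?J) = (\<Sum>y. \<integral>\<^sup>+t. ennreal (pmf (poi t) y) * ennreal t \<partial>G)"
      by (subst nn_integral_joint) auto
    also have "\<dots> = (\<Sum>y. \<integral>\<^sup>+t. ennreal (t * pmf (poi t) y) \<partial>G)"
      by (simp add: ennreal_mult'' mult.commute)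
    also have "\<dots> = (\<integral>\<^sup>+t. ennreal t \<partial>G)"
    proof (rule suminf_nn_integral_poi)
      fix t :: real assume t: "0 \<le> t"
      have "(\<lambda>y. t * pmf (poi t) y) sums t" using sums_mult[OF sums_pmf_poi[OF t], of t] by simp
      then show "(\<Sum>y. ennreal (t * pmf (poi t) y)) = ennreal t"
        using t by (subst suminf_ennreal2) (auto simp: sums_iff)
    qed auto
    finally show ?thesis using mean_finite by simp
  qed
  have int_fst: "integrable ?J fst"
  proof (rule integrableI_nonneg)
    show "AE x in ?J. 0 \<le> fst x" by (rule AE_joint_nonneg)
  qed (use fin in auto)
  have int_bayes: "integrable ?J (\<lambda>x. bayes (snd x))"
  proof (rule integrableI_nonneg)
    show "(\<integral>\<^sup>+x. ennreal (bayes (snd x)) \<partial>?J) < \<infinity>"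
      using fin est[of UNIV] theta[of UNIV] by simp
  qed auto
  show ?thesis unfolding posterior_mean_def
  proof (rule F.real_cond_exp_charact)
    fix A assume "A \<in> sets ?F"
    then obtain B where A: "A = snd -` B" by (auto simp: sets_vimage_algebra2)
    have "(\<integral>x\<in>A. fst x \<partial>?J) = enn2real (\<integral>\<^sup>+x. ennreal (indicator B (snd x) * fst x) \<partial>?J)"
      unfolding set_lebesgue_integral_def A
      using AE_joint_nonneg
      by (subst integral_eq_nn_integral) (auto simp: indicator_def vimage_def intro!: arg_cong[where f = enn2real] nn_integral_cong)
    moreover have "(\<integral>x\<in>A. bayes (snd x) \<partial>?J) = enn2real (\<integral>\<^sup>+x. ennreal (indicator B (snd x) * bayes (snd x)) \<partial>?J)"
      unfolding set_lebesgue_integral_def A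
      by (subst integral_eq_nn_integral) (auto simp: indicator_def vimage_def intro!: arg_cong[where f = enn2real] nn_integral_cong)
    ultimately show "(\<integral>x\<in>A. fst x \<partial>?J) = (\<integral>x\<in>A. bayes (snd x) \<partial>?J)"
      unfolding theta est by simp
  next
    have "snd \<in> measurable ?F (count_space UNIV)" by (rule measurable_vimage_algebra1) auto
    then show "(\<lambda>x. bayes (snd x)) \<in> borel_measurable ?F" by (rule measurable_compose) simp
  qed (rule int_fst int_bayes)+
qed

lemma nn_integral_joint_square:
  "(\<integral>\<^sup>+x. ennreal ((c (snd x) - fst x)\<^sup>2) \<partial>joint_law G) =
     (\<Sum>y. ennreal (marg y * (c y - bayes y)\<^sup>2)) + (\<Sum>y. ennreal (bayes_risk y))"
proof -
  have "(\<lambda>x. (\<lambda>y x. ennreal ((c y - fst x)\<^sup>2)) (snd x) x) \<in> borel_measurable (borel \<Otimes>\<^sub>M count_space UNIV)"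
    by (rule measurable_compose_countable) auto
  then have "(\<integral>\<^sup>+x. ennreal ((c (snd x) - fst x)\<^sup>2) \<partial>joint_law G) =
     (\<Sum>y. \<integral>\<^sup>+t. ennreal (pmf (poi t) y) * ennreal ((c y - t)\<^sup>2) \<partial>G)"
    by (subst nn_integral_joint) auto
  also have "\<dots> = (\<Sum>y. ennreal (marg y * (c y - bayes y)\<^sup>2) + ennreal (bayes_risk y))"
    unfolding nn_integral_square[symmetric] by (simp add: ennreal_mult'[symmetric] mult.commute)
  finally show ?thesis by (simp add: suminf_add)
qed

lemma mmse_eq: "mmse G = (\<Sum>y. ennreal (bayes_risk y))"
proof -
  have "mmse G = (\<integral>\<^sup>+x. ennreal ((bayes (snd x) - fst x)\<^sup>2) \<partial>joint_law G)"
    unfolding mmse_def using AE_posterior_mean by (intro nn_integral_cong_AE) auto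
  then show ?thesis unfolding nn_integral_joint_square by simp
qed

text \<open>The rule that estimates \<theta> by the observation itself has risk equal to the prior
  mean. Finiteness permits cancelling the mmse in the regret.\<close>

lemma mmse_finite: "mmse G < \<infinity>"
proof -
  have "mmse G \<le> (\<Sum>y. \<integral>\<^sup>+t. ennreal ((real y - t)\<^sup>2 * pmf (poi t) y) \<partial>G)"
    unfolding mmse_eq nn_integral_square by (intro suminf_le) auto
  also have "\<dots> = (\<integral>\<^sup>+t. ennreal t \<partial>G)"
    by (intro suminf_nn_integral_poi suminf_poi_square) auto
  finally show ?thesis using mean_finite by simp
qed

text \<open>On any set of observations, the excess of the rule that returns \<open>y\<close> is at
  most its full squared error there.\<close>

lemma tail_le:
  "(\<Sum>y. ennreal (if P y then marg y * (real y - bayes y)\<^sup>2 else 0)) \<le>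
   (\<integral>\<^sup>+t. (\<Sum>y. ennreal (if P y then (real y - t)\<^sup>2 * pmf (poi t) y else 0)) \<partial>G)"
proof -
  have "(\<Sum>y. ennreal (if P y then marg y * (real y - bayes y)\<^sup>2 else 0)) \<le>
    (\<Sum>y. \<integral>\<^sup>+t. ennreal (if P y then (real y - t)\<^sup>2 * pmf (poi t) y else 0) \<partial>G)"
    by (intro suminf_le) (auto simp: nn_integral_square)
  also have "\<dots> = (\<integral>\<^sup>+t. (\<Sum>y. ennreal (if P y then (real y - t)\<^sup>2 * pmf (poi t) y else 0)) \<partial>G)"
    by (intro suminf_nn_integral_poi) auto
  finally show ?thesis .
qed

end

section \<open>Exact regret of the Robbins estimator\<close>

lemma count_upto_Suc:
  "count_upto (Suc m) Y y = count_upto m Y y + (if Y (Suc m) = y then 1 else 0)"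
proof -
  have "{i \<in> {1..Suc m}. Y i = y} = (if Y (Suc m) = y then insert (Suc m) {i \<in> {1..m}. Y i = y} else {i \<in> {1..m}. Y i = y})"
    by (auto simp: le_Suc_eq)
  then show ?thesis by (simp add: count_upto_def)
qed

lemma count_upto_cong: "(\<And>i. i \<in> {1..m} \<Longrightarrow> Y i = Z i) \<Longrightarrow> count_upto m Y y = count_upto m Z y"
  unfolding count_upto_def by (intro arg_cong[where f = card]) auto

text \<open>The Robbins rule with the last observation and the two relevant counts as separate
  arguments, so that they can be integrated one after the other.\<close>

definition robbins_value :: "enat \<Rightarrow> nat \<Rightarrow> nat \<Rightarrow> nat \<Rightarrow> real" where
  "robbins_value y0 y a b =
     (if enat y \<le> y0 then real (y + 1) * real b / real (a + 1) else real y)"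

lemma robbins_eq:
  "robbins (Suc m) y0 Y = robbins_value y0 (Y (Suc m))
     (count_upto m Y (Y (Suc m))) (count_upto m Y (Y (Suc m) + 1))"
  by (simp add: robbins_def robbins_value_def)

context prior
begin

section \<open>The law of two counts in the sample\<close>

lemma prob_space_sample: "prob_space (sample_law m G)"
  unfolding sample_law_def by (intro prob_space_PiM prob_space_joint)

lemma nn_integral_sample_Suc:
  assumes "F \<in> borel_measurable (sample_law (Suc m) G)"
  shows "(\<integral>\<^sup>+\<omega>. F \<omega> \<partial>sample_law (Suc m) G) =
    (\<integral>\<^sup>+\<omega>. \<integral>\<^sup>+x. F (fun_upd \<omega> (Suc m) x) \<partial>joint_law G \<partial>sample_law m G)"
proof -
  interpret product_sigma_finite "\<lambda>_::nat. joint_law G"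
    by (rule product_sigma_finite.intro) (rule prob_space_imp_sigma_finite[OF prob_space_joint])
  have "{1..Suc m} = insert (Suc m) {1..m}" by auto
  then show ?thesis
    using assms unfolding sample_law_def by (simp add: product_nn_integral_insert)
qed

lemma measurable_sample_component:
  "i \<in> {1..m} \<Longrightarrow> (\<lambda>\<omega>. \<omega> i) \<in> measurable (sample_law m G) (borel \<Otimes>\<^sub>M count_space UNIV)"
  unfolding sample_law_def using measurable_component_singleton[of i "{1..m}" "\<lambda>_. joint_law G"]
  by (simp add: measurable_cong_sets[OF refl sets_joint])

lemma measurable_count_upto:
  assumes "k \<le> m"
  shows "(\<lambda>\<omega>. count_upto k (\<lambda>i. snd (\<omega> i)) y) \<in> measurable (sample_law m G) (count_space UNIV)"
  unfolding count_upto_def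
proof (rule measurable_card)
  fix i
  have "(\<lambda>\<omega>. i \<in> {i \<in> {1..k}. snd (\<omega> i) = y}) \<in> measurable (sample_law m G) (count_space UNIV)"
  proof (cases "i \<in> {1..k}")
    case True
    then have "(\<lambda>\<omega>. \<omega> i) \<in> measurable (sample_law m G) (borel \<Otimes>\<^sub>M count_space UNIV)"
      using assms by (intro measurable_sample_component) auto
    then have "(\<lambda>\<omega>. snd (\<omega> i)) \<in> measurable (sample_law m G) (count_space UNIV)"
      by (rule measurable_compose[OF _ measurable_snd])
    from measurable_compose[OF this, of "\<lambda>v. v = y" "count_space UNIV"] True show ?thesis
      by (simp only: mem_Collect_eq measurable_count_space simp_thms)
  next
    case False
    then have "(\<lambda>\<omega> :: nat \<Rightarrow> real \<times> nat. i \<in> {i \<in> {1..k}. snd (\<omega> i) = y}) = (\<lambda>\<omega>. False)" by auto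
    then show ?thesis by (simp only: measurable_const space_count_space UNIV_I)
  qed
  then show "{\<omega> \<in> space (sample_law m G). i \<in> {i \<in> {1..k}. snd (\<omega> i) = y}} \<in> sets (sample_law m G)"
    by (rule predE)
qed

lemma nn_integral_three_values:
  assumes "y \<noteq> z" "0 \<le> u" "0 \<le> v" "0 \<le> w"
  shows "(\<integral>\<^sup>+x. ennreal (if snd x = y then u else if snd x = z then v else w) \<partial>joint_law G) =
    ennreal (marg y * u + marg z * v + (1 - marg y - marg z) * w)"
proof -
  define g where "g k = (if k = y then u else if k = z then v else w)" for k
  have "(\<lambda>k. w * marg k + (if k = y then marg k * (u - w) else 0) + (if k = z then marg k * (v - w) else 0)) sums
      (w * 1 + marg y * (u - w) + marg z * (v - w))"
    by (intro sums_add sums_mult sums_marg sums_single)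
  also have "(\<lambda>k. w * marg k + (if k = y then marg k * (u - w) else 0) + (if k = z then marg k * (v - w) else 0))
      = (\<lambda>k. marg k * g k)"
    using assms(1) by (auto simp: g_def fun_eq_iff algebra_simps)
  also have "w * 1 + marg y * (u - w) + marg z * (v - w) = marg y * u + marg z * v + (1 - marg y - marg z) * w"
    by (simp add: algebra_simps)
  finally have s: "(\<lambda>k. marg k * g k) sums (marg y * u + marg z * v + (1 - marg y - marg z) * w)" .
  have g0: "0 \<le> g k" for k using assms by (simp add: g_def)
  have "(\<integral>\<^sup>+x. ennreal (g (snd x)) \<partial>joint_law G) = (\<Sum>k. ennreal (marg k * g k))"
    by (subst nn_integral_joint_snd) (simp add: ennreal_mult g0)
  also have "\<dots> = ennreal (marg y * u + marg z * v + (1 - marg y - marg z) * w)"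
    using s g0 by (subst suminf_ennreal2) (auto simp: sums_iff)
  finally show ?thesis by (simp add: g_def)
qed

text \<open>The pair of counts takes values in a countable discrete space, on which every function
  is measurable.\<close>

lemma borel_measurable_counts:
  assumes "k \<le> m"
  shows "(\<lambda>\<omega>. \<psi> (count_upto k (\<lambda>i. snd (\<omega> i)) y) (count_upto k (\<lambda>i. snd (\<omega> i)) z))
    \<in> borel_measurable (sample_law m G)"
proof -
  note [measurable] = measurable_count_upto[OF assms]
  have "(\<lambda>\<omega>. (count_upto k (\<lambda>i. snd (\<omega> i)) y, count_upto k (\<lambda>i. snd (\<omega> i)) z))
      \<in> measurable (sample_law m G) (count_space UNIV \<Otimes>\<^sub>M count_space UNIV)" by measurable
  then have pair: "(\<lambda>\<omega>. (count_upto k (\<lambda>i. snd (\<omega> i)) y, count_upto k (\<lambda>i. snd (\<omega> i)) z))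
      \<in> measurable (sample_law m G) (count_space UNIV)"
    unfolding pair_measure_countable[OF countableI_type countableI_type] UNIV_Times_UNIV .
  have "(\<lambda>(a, b). \<psi> a b) \<in> measurable (count_space UNIV) borel"
    by (simp only: measurable_count_space_eq1) simp
  from measurable_compose[OF pair this] show ?thesis
    by (simp only: case_prod_conv)
qed

text \<open>Two counts at distinct values are trinomial. Integrating out the last observation gives
  the recursion of \<open>trisum\<close>; \<open>\<phi>\<close> varies in the induction because each
  outcome shifts one of its arguments.\<close>

lemma nn_integral_counts:
  assumes yz: "y \<noteq> z" and "\<And>a b. 0 \<le> \<phi> a b"
  shows "(\<integral>\<^sup>+\<omega>. ennreal (\<phi> (count_upto m (\<lambda>i. snd (\<omega> i)) y) (count_upto m (\<lambda>i. snd (\<omega> i)) z)) \<partial>sample_law m G) =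
    ennreal (trisum m (marg y) (marg z) (1 - marg y - marg z) \<phi>)"
  using assms(2)
proof (induction m arbitrary: \<phi>)
  case 0
  interpret S: prob_space "sample_law 0 G" by (rule prob_space_sample)
  show ?case by (simp add: count_upto_def S.emeasure_space_1)
next
  case (Suc m)
  let ?N = "\<lambda>\<omega>. count_upto m (\<lambda>i. snd (\<omega> i)) :: nat \<Rightarrow> nat"
  let ?x = "marg y" and ?y = "marg z" and ?z = "1 - marg y - marg z"
  have N: "count_upto (Suc m) (\<lambda>i. snd ((fun_upd \<omega> (Suc m) x) i)) k =
     ?N \<omega> k + (if snd x = k then 1 else 0)" for \<omega> :: "nat \<Rightarrow> real \<times> nat" and x k
    unfolding count_upto_Suc by (auto intro!: count_upto_cong)
  have z: "0 \<le> ?z" using marg_pair_le[OF yz] by simp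
  have meas: "(\<lambda>\<omega>. ennreal (\<psi> (?N \<omega> y) (?N \<omega> z))) \<in> borel_measurable (sample_law m G)" for \<psi> :: "nat \<Rightarrow> nat \<Rightarrow> real"
    by (rule borel_measurable_counts[of m m "\<lambda>a b. ennreal (\<psi> a b)"]) simp
  have "(\<integral>\<^sup>+\<omega>. ennreal (\<phi> (count_upto (Suc m) (\<lambda>i. snd (\<omega> i)) y) (count_upto (Suc m) (\<lambda>i. snd (\<omega> i)) z)) \<partial>sample_law (Suc m) G) =
    (\<integral>\<^sup>+\<omega>. \<integral>\<^sup>+x. ennreal (\<phi> (?N \<omega> y + (if snd x = y then 1 else 0)) (?N \<omega> z + (if snd x = z then 1 else 0))) \<partial>joint_law G \<partial>sample_law m G)"
    using nn_integral_sample_Suc[OF borel_measurable_counts[of "Suc m" "Suc m" "\<lambda>a b. ennreal (\<phi> a b)" y z]]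
    by (simp only: N order_refl)
  also have "\<dots> = (\<integral>\<^sup>+\<omega>. ennreal ?x * ennreal (\<phi> (Suc (?N \<omega> y)) (?N \<omega> z))
      + ennreal ?y * ennreal (\<phi> (?N \<omega> y) (Suc (?N \<omega> z)))
      + ennreal ?z * ennreal (\<phi> (?N \<omega> y) (?N \<omega> z)) \<partial>sample_law m G)"
  proof (rule nn_integral_cong)
    fix \<omega>
    have "(\<integral>\<^sup>+x. ennreal (\<phi> (?N \<omega> y + (if snd x = y then 1 else 0)) (?N \<omega> z + (if snd x = z then 1 else 0))) \<partial>joint_law G) =
      (\<integral>\<^sup>+x. ennreal (if snd x = y then \<phi> (Suc (?N \<omega> y)) (?N \<omega> z) else if snd x = z then \<phi> (?N \<omega> y) (Suc (?N \<omega> z)) else \<phi> (?N \<omega> y) (?N \<omega> z)) \<partial>joint_law G)"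
      using yz by (intro nn_integral_cong) auto
    also have "\<dots> = ennreal (?x * \<phi> (Suc (?N \<omega> y)) (?N \<omega> z) + ?y * \<phi> (?N \<omega> y) (Suc (?N \<omega> z)) + ?z * \<phi> (?N \<omega> y) (?N \<omega> z))"
      using yz Suc.prems by (intro nn_integral_three_values) auto
    also have "\<dots> = ennreal ?x * ennreal (\<phi> (Suc (?N \<omega> y)) (?N \<omega> z))
      + ennreal ?y * ennreal (\<phi> (?N \<omega> y) (Suc (?N \<omega> z)))
      + ennreal ?z * ennreal (\<phi> (?N \<omega> y) (?N \<omega> z))"
      using z Suc.prems by (simp add: ennreal_plus ennreal_mult)
    finally show "(\<integral>\<^sup>+x. ennreal (\<phi> (?N \<omega> y + (if snd x = y then 1 else 0)) (?N \<omega> z + (if snd x = z then 1 else 0))) \<partial>joint_law G) =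
      ennreal ?x * ennreal (\<phi> (Suc (?N \<omega> y)) (?N \<omega> z))
      + ennreal ?y * ennreal (\<phi> (?N \<omega> y) (Suc (?N \<omega> z)))
      + ennreal ?z * ennreal (\<phi> (?N \<omega> y) (?N \<omega> z))" .
  qed
  also have "\<dots> = ennreal ?x * (\<integral>\<^sup>+\<omega>. ennreal (\<phi> (Suc (?N \<omega> y)) (?N \<omega> z)) \<partial>sample_law m G)
      + ennreal ?y * (\<integral>\<^sup>+\<omega>. ennreal (\<phi> (?N \<omega> y) (Suc (?N \<omega> z))) \<partial>sample_law m G)
      + ennreal ?z * (\<integral>\<^sup>+\<omega>. ennreal (\<phi> (?N \<omega> y) (?N \<omega> z)) \<partial>sample_law m G)"
  proof -
    have linear: "(\<integral>\<^sup>+\<omega>. a * F \<omega> + b * F' \<omega> + c * F'' \<omega> \<partial>sample_law m G) =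
       a * integral\<^sup>N (sample_law m G) F + b * integral\<^sup>N (sample_law m G) F' + c * integral\<^sup>N (sample_law m G) F''"
      if [measurable]: "F \<in> borel_measurable (sample_law m G)" "F' \<in> borel_measurable (sample_law m G)"
        "F'' \<in> borel_measurable (sample_law m G)" for a b c F F' F''
      by (simp add: nn_integral_add nn_integral_cmult)
    show ?thesis
      by (rule linear[OF meas[of "\<lambda>a b. \<phi> (Suc a) b"] meas[of "\<lambda>a b. \<phi> a (Suc b)"] meas[of \<phi>]])
  qed
  also have "\<dots> = ennreal ?x * ennreal (trisum m ?x ?y ?z (\<lambda>a b. \<phi> (Suc a) b))
      + ennreal ?y * ennreal (trisum m ?x ?y ?z (\<lambda>a b. \<phi> a (Suc b))) + ennreal ?z * ennreal (trisum m ?x ?y ?z \<phi>)"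
    using Suc.IH[of "\<lambda>a b. \<phi> (Suc a) b"] Suc.IH[of "\<lambda>a b. \<phi> a (Suc b)"] Suc.IH[of \<phi>] Suc.prems
    by simp
  also have "\<dots> = ennreal (trisum (Suc m) ?x ?y ?z \<phi>)"
    using z Suc.prems by (simp add: ennreal_mult[symmetric] ennreal_plus[symmetric] trisum_nonneg del: ennreal_plus)
  finally show ?case .
qed

text \<open>The contribution of the observation \<open>Y = y\<close> to the excess risk.\<close>

definition excess :: "enat \<Rightarrow> nat \<Rightarrow> nat \<Rightarrow> real" where
  "excess y0 m y = (if enat y \<le> y0
     then (real (y + 1))\<^sup>2 * (marg y * ratio_risk m (marg y) (marg (y + 1)))
     else marg y * (real y - bayes y)\<^sup>2)"

lemma ratio_risk_marg_nonneg: "0 \<le> ratio_risk m (marg y) (marg (y + 1))"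
  using marg_pair_le[of y "y + 1"] by (intro ratio_risk_nonneg) auto

lemma excess_nonneg: "0 \<le> excess y0 m y"
  using ratio_risk_marg_nonneg[of m y] by (simp add: excess_def)

lemma nn_integral_excess:
  "(\<integral>\<^sup>+\<omega>. ennreal (marg y * (robbins_value y0 y (count_upto m (\<lambda>i. snd (\<omega> i)) y)
      (count_upto m (\<lambda>i. snd (\<omega> i)) (y + 1)) - bayes y)\<^sup>2) \<partial>sample_law m G) = ennreal (excess y0 m y)"
proof (cases "enat y \<le> y0")
  case True
  let ?N = "\<lambda>\<omega>. count_upto m (\<lambda>i. snd (\<omega> i)) :: nat \<Rightarrow> nat"
  define \<phi> where "\<phi> a b = (real b / real (a + 1) - marg (y + 1) / marg y)\<^sup>2" for a b
  have \<phi>0: "0 \<le> \<phi> a b" for a b by (simp add: \<phi>_def)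
  have sq: "marg y * (robbins_value y0 y a b - bayes y)\<^sup>2 = ((real (y + 1))\<^sup>2 * marg y) * \<phi> a b" for a b
  proof -
    have "robbins_value y0 y a b - bayes y = real (y + 1) * (real b / real (a + 1) - marg (y + 1) / marg y)"
      using True by (simp add: robbins_value_def bayes_def right_diff_distrib del: of_nat_add)
    then show ?thesis by (simp only: \<phi>_def power_mult_distrib mult_ac)
  qed
  have "(\<integral>\<^sup>+\<omega>. ennreal (marg y * (robbins_value y0 y (?N \<omega> y) (?N \<omega> (y + 1)) - bayes y)\<^sup>2) \<partial>sample_law m G)
    = (\<integral>\<^sup>+\<omega>. ennreal ((real (y + 1))\<^sup>2 * marg y) * ennreal (\<phi> (?N \<omega> y) (?N \<omega> (y + 1))) \<partial>sample_law m G)"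
    unfolding sq by (intro nn_integral_cong ennreal_mult) (auto simp: \<phi>_def)
  also have "\<dots> = ennreal ((real (y + 1))\<^sup>2 * marg y) * ennreal (ratio_risk m (marg y) (marg (y + 1)))"
    unfolding ratio_risk_def \<phi>_def[symmetric, abs_def]
    using nn_integral_cmult[OF borel_measurable_counts[of m m "\<lambda>a b. ennreal (\<phi> a b)" y "y + 1"], of "ennreal ((real (y + 1))\<^sup>2 * marg y)"]
      nn_integral_counts[of y "y + 1" \<phi> m] \<phi>0
    by simp
  also have "\<dots> = ennreal (excess y0 m y)"
    using True by (simp add: excess_def ennreal_mult''[symmetric] ratio_risk_marg_nonneg[simplified] mult.assoc)
  finally show ?thesis .
next
  case False
  interpret S: prob_space "sample_law m G" by (rule prob_space_sample)
  show ?thesis using False by (simp add: robbins_value_def excess_def S.emeasure_space_1)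
qed

text \<open>The counts depend only on the first \<open>m\<close> pairs. With these fixed, the
  estimator is a function of the last observation alone, so the orthogonal decomposition applies to
  the last pair; integrating over the first \<open>m\<close> pairs then gives
  \<open>excess\<close>.\<close>

lemma risk_robbins:
  "risk (Suc m) (robbins (Suc m) y0) G = (\<Sum>y. ennreal (excess y0 m y)) + mmse G"
proof -
  interpret S: prob_space "sample_law m G" by (rule prob_space_sample)
  let ?N = "\<lambda>\<omega>. count_upto m (\<lambda>i. snd (\<omega> i)) :: nat \<Rightarrow> nat"
  let ?r = "\<lambda>\<omega> y. robbins_value y0 y (?N \<omega> y) (?N \<omega> (y + 1))"
  have N: "count_upto m (\<lambda>i. snd ((fun_upd \<omega> (Suc m) x) i)) k = ?N \<omega> k" for \<omega> :: "nat \<Rightarrow> real \<times> nat" and x k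
    by (auto intro!: count_upto_cong)
  have [measurable]: "(\<lambda>\<omega>. \<omega> (Suc m)) \<in> measurable (sample_law (Suc m) G) (borel \<Otimes>\<^sub>M count_space UNIV)"
    by (rule measurable_sample_component) simp
  have "(\<lambda>\<omega>. (\<lambda>y \<omega>. ennreal ((?r \<omega> y - fst (\<omega> (Suc m)))\<^sup>2)) (snd (\<omega> (Suc m))) \<omega>) \<in> borel_measurable (sample_law (Suc m) G)"
  proof (rule measurable_compose_countable[where f = "\<lambda>y \<omega>. ennreal ((?r \<omega> y - fst (\<omega> (Suc m)))\<^sup>2)" and g = "\<lambda>\<omega>. snd (\<omega> (Suc m))"])
    fix y
    have [measurable]: "(\<lambda>\<omega>. ?r \<omega> y) \<in> borel_measurable (sample_law (Suc m) G)"
      by (rule borel_measurable_counts[of m "Suc m" "robbins_value y0 y" y "y + 1"]) simp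
    show "(\<lambda>\<omega>. ennreal ((?r \<omega> y - fst (\<omega> (Suc m)))\<^sup>2)) \<in> borel_measurable (sample_law (Suc m) G)"
      by measurable
  qed measurable
  then have "risk (Suc m) (robbins (Suc m) y0) G =
    (\<integral>\<^sup>+\<omega>. \<integral>\<^sup>+x. ennreal ((?r \<omega> (snd x) - fst x)\<^sup>2) \<partial>joint_law G \<partial>sample_law m G)"
    unfolding risk_def robbins_eq using nn_integral_sample_Suc by (simp only: N fun_upd_same)
  also have "\<dots> = (\<integral>\<^sup>+\<omega>. (\<Sum>y. ennreal (marg y * (?r \<omega> y - bayes y)\<^sup>2)) + mmse G \<partial>sample_law m G)"
  proof (rule nn_integral_cong)
    fix \<omega>
    show "(\<integral>\<^sup>+x. ennreal ((?r \<omega> (snd x) - fst x)\<^sup>2) \<partial>joint_law G) =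
      (\<Sum>y. ennreal (marg y * (?r \<omega> y - bayes y)\<^sup>2)) + mmse G"
      using nn_integral_joint_square[of "?r \<omega>"] by (simp only: mmse_eq)
  qed
  also have "\<dots> = (\<Sum>y. \<integral>\<^sup>+\<omega>. ennreal (marg y * (?r \<omega> y - bayes y)\<^sup>2) \<partial>sample_law m G) + mmse G"
  proof -
    have meas: "(\<lambda>\<omega>. ennreal (marg y * (?r \<omega> y - bayes y)\<^sup>2)) \<in> borel_measurable (sample_law m G)" for y
      by (rule borel_measurable_counts[of m m "\<lambda>a b. ennreal (marg y * (robbins_value y0 y a b - bayes y)\<^sup>2)" y "y + 1"]) simp
    have "(\<integral>\<^sup>+\<omega>. (\<Sum>y. F y \<omega>) + c \<partial>sample_law m G) = (\<Sum>y. integral\<^sup>N (sample_law m G) (F y)) + c"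
      if [measurable]: "\<And>y. F y \<in> borel_measurable (sample_law m G)" for F :: "nat \<Rightarrow> _" and c
      by (simp add: nn_integral_add nn_integral_suminf S.emeasure_space_1)
    from this[of "\<lambda>y \<omega>. ennreal (marg y * (?r \<omega> y - bayes y)\<^sup>2)", OF meas] show ?thesis .
  qed
  finally show ?thesis unfolding nn_integral_excess .
qed

lemma excess_regret:
  "enn2ereal (risk (Suc m) (robbins (Suc m) y0) G) - enn2ereal (mmse G) =
     enn2ereal (\<Sum>y. ennreal (excess y0 m y))"
proof -
  obtain b where b: "mmse G = ennreal b" "b \<ge> 0"
    using mmse_finite by (cases "mmse G") auto
  show ?thesis
    unfolding risk_robbins plus_ennreal.rep_eq b using b(2)
    by (cases "enn2ereal (\<Sum>y. ennreal (excess y0 m y))") auto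
qed

end

text \<open>The mean is finite because \<open>u \<le> 1 + u powr p\<close>.\<close>

lemma prior_moment_class:
  assumes "p > 1" "G \<in> moment_class p"
  shows "prior G"
proof -
  have G: "prob_space G" "sets G = sets borel" "AE u in G. 0 \<le> u"
    "(\<integral>\<^sup>+ u. ennreal (u powr p) \<partial>G) \<le> 1"
    using assms(2) by (auto simp: moment_class_def)
  interpret prob_space G by fact
  note [measurable_cong] = G(2)
  have "(\<integral>\<^sup>+ u. ennreal u \<partial>G) \<le> (\<integral>\<^sup>+ u. 1 + ennreal (u powr p) \<partial>G)"
  proof (rule nn_integral_mono)
    fix u :: real
    show "ennreal u \<le> 1 + ennreal (u powr p)"
    proof (cases "u \<le> 1")
      case True
      then have "ennreal u \<le> 1" by (simp add: ennreal_le_1)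
      then show ?thesis by (simp add: add_increasing2)
    next
      case False
      then have "u powr 1 \<le> u powr p" using assms(1) by (intro powr_mono) auto
      then have "ennreal u \<le> ennreal (u powr p)" using False by (intro ennreal_leI) auto
      then show ?thesis by (simp add: add_increasing)
    qed
  qed
  also have "\<dots> = 1 + (\<integral>\<^sup>+ u. ennreal (u powr p) \<partial>G)"
    by (simp add: nn_integral_add emeasure_space_1)
  also have "\<dots> \<le> 1 + 1" using G(4) by (intro add_left_mono)
  finally have "(\<integral>\<^sup>+ u. ennreal u \<partial>G) < \<infinity>"
    by (rule le_less_trans) simp
  with G show ?thesis by (simp add: prior_def prior_axioms_def)
qed

lemma robbins_regret_eq:
  assumes "p > 1"
  shows "robbins_regret p (Suc m) y0 =
    (SUP G\<in>moment_class p. enn2ereal (\<Sum>y. ennreal (prior.excess G y0 m y)))"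
  unfolding robbins_regret_def regret_def
  using prior.excess_regret[OF prior_moment_class[OF assms]] by (intro SUP_cong) auto

section \<open>Upper bound\<close>

text \<open>An outcome of probability zero never occurs. This settles the case
  \<open>marg (y + 1) = 0\<close>, where the target ratio is 0 too.\<close>

lemma trisum_zero:
  assumes "\<And>a. \<phi> a 0 = 0"
  shows "trisum m x 0 z \<phi> = 0"
  using assms by (induction m arbitrary: \<phi>) simp_all

context prior
begin

lemma marg_ratio_risk_le:
  assumes "m \<ge> 1"
  shows "(real (y + 1))\<^sup>2 * (marg y * ratio_risk m (marg y) (marg (y + 1))) \<le>
    6 * (real (y + 1) * bayes y + (bayes y)\<^sup>2) * min (marg y) (1 / real (m + 1))"
proof (cases "marg y = 0 \<or> marg (y + 1) = 0")
  case True
  then have "marg y * ratio_risk m (marg y) (marg (y + 1)) = 0"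
    by (auto simp: ratio_risk_def trisum_zero)
  moreover have "0 \<le> 6 * (real (y + 1) * bayes y + (bayes y)\<^sup>2) * min (marg y) (1 / real (m + 1))"
    by (intro mult_nonneg_nonneg add_nonneg_nonneg) auto
  ultimately show ?thesis by (simp only: mult_zero_right)
next
  case False
  then have pos: "marg y > 0" "marg (y + 1) > 0"
    using marg_nonneg[of y] marg_nonneg[of "y + 1"] by linarith+
  have le: "marg y + marg (y + 1) \<le> 1" by (rule marg_pair_le) simp
  let ?r = "marg (y + 1) / marg y"
  have "(real (y + 1))\<^sup>2 * (marg y * ratio_risk m (marg y) (marg (y + 1))) \<le>
     (real (y + 1))\<^sup>2 * (6 * (?r + ?r\<^sup>2) * min (marg y) (1 / real (m + 1)))"
    using pos le assms by (intro mult_left_mono ratio_risk_le) auto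
  also have "\<dots> = 6 * (real (y + 1) * bayes y + (bayes y)\<^sup>2) * min (marg y) (1 / real (m + 1))"
  proof -
    have b: "bayes y = real (y + 1) * ?r" by (simp add: bayes_def)
    show ?thesis unfolding b by (simp only: power2_eq_square) (simp only: algebra_simps)
  qed
  finally show ?thesis .
qed

text \<open>The posterior second moment is split at \<open>t = T\<close>: below it is at most
  \<open>T\<^sup>2 * marg y\<close>, above it the Poisson mass contributes \<open>128 / n\<close>.
  If \<open>marg y\<close> exceeds \<open>1 / n\<close>, the bound is divided by
  \<open>n * marg y\<close>, which is then at least 1.\<close>

lemma bayes_square_min_le:
  assumes n: "n \<ge> 1" and T: "T \<ge> 4 * real y" "T \<ge> 8 * ln (real n)"
  shows "(bayes y)\<^sup>2 * min (marg y) (1 / real n) \<le> (T\<^sup>2 + 128) / real n"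
proof -
  have T0: "T \<ge> 0" using T(1) by linarith
  have "(\<integral>t. t\<^sup>2 * pmf (poi t) y \<partial>G) \<le> (\<integral>t. T\<^sup>2 * pmf (poi t) y + 128 / real n \<partial>G)"
  proof (rule integral_mono_AE)
    show "AE t in G. t\<^sup>2 * pmf (poi t) y \<le> T\<^sup>2 * pmf (poi t) y + 128 / real n"
      using nonneg
    proof eventually_elim
      case (elim t)
      show ?case
      proof (cases "t \<le> T")
        case True
        then have "t\<^sup>2 * pmf (poi t) y \<le> T\<^sup>2 * pmf (poi t) y"
          using elim by (intro mult_right_mono power_mono) auto
        then show ?thesis by (simp add: add_increasing2)
      next
        case False
        then have "t\<^sup>2 * pmf (poi t) y \<le> 128 / real n"
          using n T by (intro square_poi_le_inverse) auto
        then show ?thesis by (simp add: add_increasing)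
      qed
    qed
  qed (auto intro: integrable_second)
  also have "\<dots> = T\<^sup>2 * marg y + 128 / real n"
    using prob_space by (simp add: marg_def)
  finally have le: "(bayes y)\<^sup>2 * marg y \<le> T\<^sup>2 * marg y + 128 / real n"
    using bayes_square_le[of y] by linarith
  show ?thesis
  proof (cases "marg y \<le> 1 / real n")
    case True
    then have "T\<^sup>2 * marg y \<le> T\<^sup>2 * (1 / real n)" by (intro mult_left_mono) auto
    with le True show ?thesis by (simp add: add_divide_distrib min_def)
  next
    case False
    then have pos: "marg y > 1 / real n" "marg y > 0"
      using n by (auto intro: less_trans[of 0 "1 / real n"])
    have nm: "1 / (real n * marg y) \<le> 1" using pos n by (simp add: field_simps)
    have "(bayes y)\<^sup>2 / real n = (bayes y)\<^sup>2 * marg y * (1 / (real n * marg y))"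
      using pos by simp
    also have "\<dots> \<le> (T\<^sup>2 * marg y + 128 / real n) * (1 / (real n * marg y))"
      using le pos by (intro mult_right_mono) auto
    also have "\<dots> = T\<^sup>2 / real n + 128 / real n * (1 / (real n * marg y))"
      using pos by (simp add: add_divide_distrib)
    also have "\<dots> \<le> T\<^sup>2 / real n + 128 / real n * 1"
      by (intro add_left_mono mult_left_mono nm) auto
    finally show ?thesis using False by (simp add: add_divide_distrib)
  qed
qed

lemma excess_head_le:
  assumes m: "m \<ge> 1" and y: "y \<le> k" and k: "k \<ge> 1"
  shows "excess (enat k) m y \<le> 2688 * (real k * (1 + ln (real (Suc m))))\<^sup>2 / real (Suc m)"
proof -
  define n where "n = real (Suc m)"
  define A where "A = real k * (1 + ln n)"
  \<comment> \<open>One threshold dominates \<open>4 * y\<close>, \<open>8 * ln n\<close>,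
    \<open>y + 1\<close> and the number 8 together. The last of these absorbs the constant 256, and
    \<open>6 * 7 * 8\<^sup>2 = 2688\<close>.\<close>
  define T where "T = 8 * A"
  have L: "0 \<le> ln n" using m by (simp add: n_def)
  have "real k * 1 \<le> A" unfolding A_def using L by (intro mult_left_mono) auto
  moreover have "1 * (1 + ln n) \<le> A" unfolding A_def using L k by (intro mult_right_mono) auto
  ultimately have T: "4 * real y \<le> T" "8 * ln n \<le> T" "real (y + 1) \<le> T" "8 \<le> T"
    using y k L by (auto simp: T_def)
  have n: "n > 0" by (simp add: n_def)
  let ?M = "min (marg y) (1 / n)"
  have M: "0 \<le> ?M" "?M \<le> 1 / n" using n by auto
  have "real (y + 1) * bayes y \<le> (real (y + 1))\<^sup>2 + (bayes y)\<^sup>2"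
  proof -
    have "0 \<le> (real (y + 1) - bayes y)\<^sup>2" by simp
    then show ?thesis using mult_nonneg_nonneg[OF of_nat_0_le_iff bayes_nonneg, of "y + 1" y]
      unfolding power2_diff by linarith
  qed
  also have "(real (y + 1))\<^sup>2 \<le> T\<^sup>2" using T by (intro power_mono) auto
  finally have 1: "real (y + 1) * bayes y + (bayes y)\<^sup>2 \<le> T\<^sup>2 + 2 * (bayes y)\<^sup>2" by simp
  have "excess (enat k) m y \<le> 6 * (real (y + 1) * bayes y + (bayes y)\<^sup>2) * ?M"
    using y marg_ratio_risk_le[OF m, of y] by (simp add: excess_def n_def)
  also have "\<dots> \<le> 6 * (T\<^sup>2 + 2 * (bayes y)\<^sup>2) * ?M"
    using 1 M by (intro mult_right_mono mult_left_mono) auto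
  also have "\<dots> = 6 * (T\<^sup>2 * ?M + 2 * ((bayes y)\<^sup>2 * ?M))" by (simp only: algebra_simps)
  also have "\<dots> \<le> 6 * (T\<^sup>2 * (1 / n) + 2 * ((T\<^sup>2 + 128) / n))"
    using bayes_square_min_le[of "Suc m" y T] T M unfolding n_def
    by (intro mult_left_mono add_mono) auto
  also have "\<dots> = 6 * (3 * T\<^sup>2 + 256) / n" by (simp add: add_divide_distrib)
  also have "\<dots> \<le> 6 * (7 * T\<^sup>2) / n"
  proof -
    have "8\<^sup>2 \<le> T\<^sup>2" using T(4) by (intro power_mono) auto
    then show ?thesis using n by (intro divide_right_mono) auto
  qed
  also have "\<dots> = 2688 * (real k * (1 + ln n))\<^sup>2 / n" by (simp add: T_def A_def power_mult_distrib)
  finally show ?thesis by (simp add: n_def)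
qed

end

text \<open>The \<open>k + 1\<close> terms up to \<open>k\<close> have a common bound. The terms
  beyond \<open>k\<close> are a truncated Poisson variance integrated over the prior, where the
  moment condition bounds the integral of \<open>1 + t powr p\<close> by 2.\<close>

lemma suminf_excess_le:
  fixes p :: real
  assumes p: "p > 1"
  obtains D where "D > 0" "\<And>G m k. G \<in> moment_class p \<Longrightarrow> m \<ge> 1 \<Longrightarrow> k \<ge> 1 \<Longrightarrow>
    (\<Sum>y. ennreal (prior.excess G (enat k) m y)) \<le>
      ennreal (D * (real k ^ 3 * ln (real (Suc m)) ^ 3 / real (Suc m) + real k powr (- (p - 1))))"
proof -
  obtain C where C: "C > 0" "\<And>t k. 0 \<le> t \<Longrightarrow> 1 \<le> k \<Longrightarrow>
     (\<Sum>y. ennreal (if y > k then (real y - t)\<^sup>2 * pmf (poi t) y else 0))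
       \<le> ennreal (C * real k powr (- (p - 1)) * (1 + t powr p))"
    using poi_square_tail_le[OF p] by blast
  show thesis
  proof (rule that)
    show "96768 + 2 * C > 0" using C by simp
    fix G :: "real measure" and m k :: nat
    assume G: "G \<in> moment_class p" and m: "m \<ge> 1" and k: "k \<ge> 1"
    interpret prior G by (rule prior_moment_class[OF p G])
    define n where "n = real (Suc m)"
    define L where "L = ln n"
    have n: "n \<ge> 2" using m by (simp add: n_def)
    have L: "L \<ge> 1/2"
    proof -
      have "1/2 \<le> ln (2::real)" using ln2_ge_two_thirds by simp
      also have "\<dots> \<le> L" using n by (simp add: L_def)
      finally show ?thesis .
    qed
    let ?h = "2688 * (real k * (1 + L))\<^sup>2 / n"
    have "(\<Sum>y. ennreal (excess (enat k) m y)) =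
       (\<Sum>y. ennreal (if y \<le> k then excess (enat k) m y else 0) + ennreal (if y > k then marg y * (real y - bayes y)\<^sup>2 else 0))"
      by (intro suminf_cong) (auto simp: excess_def)
    also have "\<dots> = (\<Sum>y. ennreal (if y \<le> k then excess (enat k) m y else 0)) + (\<Sum>y. ennreal (if y > k then marg y * (real y - bayes y)\<^sup>2 else 0))"
      by (rule suminf_add[symmetric]) auto
    also have "(\<Sum>y. ennreal (if y \<le> k then excess (enat k) m y else 0)) \<le> ennreal (96768 * (real k ^ 3 * L ^ 3 / n))"
    proof -
      have "(\<Sum>y. ennreal (if y \<le> k then excess (enat k) m y else 0)) = (\<Sum>y\<le>k. ennreal (excess (enat k) m y))"
        by (subst suminf_finite[of "{..k}"]) auto
      also have "\<dots> \<le> (\<Sum>y\<le>k. ennreal ?h)"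
        using excess_head_le[OF m _ k] by (intro sum_mono ennreal_leI) (simp add: n_def L_def)
      also have "\<dots> = ennreal (real (Suc k) * ?h)"
        using n by (subst sum_ennreal) auto
      also have "\<dots> \<le> ennreal (96768 * (real k ^ 3 * L ^ 3 / n))"
      proof (rule ennreal_leI)
        have "real (Suc k) * ?h \<le> (2 * real k) * ?h" using k n by (intro mult_right_mono) auto
        also have "\<dots> = 5376 * (real k ^ 3 * (1 + L)\<^sup>2 / n)"
          by (simp add: power_mult_distrib power2_eq_square power3_eq_cube)
        also have "\<dots> \<le> 5376 * (real k ^ 3 * (18 * L ^ 3) / n)"
        proof (intro mult_left_mono divide_right_mono)
          \<comment> \<open>From \<open>L \<ge> 1/2\<close> follow \<open>1 + L \<le> 3 * L\<close>
            and \<open>1 \<le> 2 * L\<close>, which leave a pure power of the logarithm.\<close>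
          have "(1 + L)\<^sup>2 \<le> (3 * L)\<^sup>2" using L by (intro power_mono) auto
          also have "\<dots> = 9 * L\<^sup>2 * 1" by (simp add: power_mult_distrib)
          also have "\<dots> \<le> 9 * L\<^sup>2 * (2 * L)" using L by (intro mult_left_mono) auto
          finally show "(1 + L)\<^sup>2 \<le> 18 * L ^ 3" by (simp add: power2_eq_square power3_eq_cube)
        qed (use n in auto)
        finally show "real (Suc k) * ?h \<le> 96768 * (real k ^ 3 * L ^ 3 / n)" by simp
      qed
      finally show ?thesis .
    qed
    also have "(\<Sum>y. ennreal (if y > k then marg y * (real y - bayes y)\<^sup>2 else 0)) \<le> ennreal (2 * C * real k powr (- (p - 1)))"
    proof -
      let ?c = "C * real k powr (- (p - 1))"
      have moment: "(\<integral>\<^sup>+t. ennreal (t powr p) \<partial>G) \<le> 1" using G by (simp add: moment_class_def)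
      have "(\<Sum>y. ennreal (if y > k then marg y * (real y - bayes y)\<^sup>2 else 0)) \<le>
        (\<integral>\<^sup>+t. (\<Sum>y. ennreal (if y > k then (real y - t)\<^sup>2 * pmf (poi t) y else 0)) \<partial>G)"
        by (rule tail_le)
      also have "\<dots> \<le> (\<integral>\<^sup>+t. ennreal ?c * (1 + ennreal (t powr p)) \<partial>G)"
      proof (rule nn_integral_mono_AE)
        show "AE t in G. (\<Sum>y. ennreal (if y > k then (real y - t)\<^sup>2 * pmf (poi t) y else 0)) \<le> ennreal ?c * (1 + ennreal (t powr p))"
          using nonneg
        proof eventually_elim
          case (elim t)
          have "ennreal (?c * (1 + t powr p)) = ennreal ?c * (1 + ennreal (t powr p))"
            using C(1) by (simp add: ennreal_mult ennreal_plus[symmetric] del: ennreal_plus flip: ennreal_1)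
          with C(2)[OF elim k] show ?case by simp
        qed
      qed
      also have "\<dots> = ennreal ?c * (1 + (\<integral>\<^sup>+t. ennreal (t powr p) \<partial>G))"
        using emeasure_space_1 by (simp add: nn_integral_cmult nn_integral_add)
      also have "\<dots> \<le> ennreal ?c * (1 + 1)" using moment by (intro mult_left_mono add_left_mono) auto
      also have "\<dots> = ennreal (2 * C * real k powr (- (p - 1)))"
        using C(1) by (simp add: ennreal_mult mult_ac)
      finally show ?thesis .
    qed
    also have "ennreal (96768 * (real k ^ 3 * L ^ 3 / n)) + ennreal (2 * C * real k powr (- (p - 1))) \<le>
      ennreal ((96768 + 2 * C) * (real k ^ 3 * L ^ 3 / n + real k powr (- (p - 1))))"
    proof -
      have "0 \<le> real k ^ 3 * L ^ 3 / n" using n L by simp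
      moreover have "96768 * u + 2 * C * v \<le> (96768 + 2 * C) * (u + v)" if "0 \<le> u" "0 \<le> v" for u v
        using mult_nonneg_nonneg[of C u] that C(1) by (simp add: distrib_left distrib_right)
      ultimately have "96768 * (real k ^ 3 * L ^ 3 / n) + 2 * C * real k powr (- (p - 1)) \<le>
         (96768 + 2 * C) * (real k ^ 3 * L ^ 3 / n + real k powr (- (p - 1)))"
        by (simp only: mult.assoc powr_ge_zero)
      then show ?thesis using n L C(1) by (subst ennreal_plus[symmetric]) (auto intro!: ennreal_leI simp del: ennreal_plus)
    qed
    finally show "(\<Sum>y. ennreal (excess (enat k) m y)) \<le>
      ennreal ((96768 + 2 * C) * (real k ^ 3 * ln (real (Suc m)) ^ 3 / real (Suc m) + real k powr (- (p - 1))))"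
      by (simp add: n_def L_def add_mono)
  qed
qed

text \<open>Up to rounding, \<open>k = (n / (ln n) ^ 3) powr (1 / (p + 2))\<close> balances the two
  terms.\<close>

lemma truncation_level_exists:
  fixes p :: real
  assumes p: "p > 1" and n: "n \<ge> (2::nat)"
  obtains k where "k \<ge> 1" "real k ^ 3 * ln (real n) ^ 3 / real n + real k powr (- (p - 1)) \<le>
     21953 * (real n powr (- ((p - 1) / (p + 2))) * ln (real n) powr (3 * (p - 1) / (p + 2)))"
proof -
  define L where "L = ln (real n)"
  have L: "L > 0" using n by (simp add: L_def)
  define z where "z = real n / L ^ 3"
  have z: "z > 0" using n L by (simp add: z_def)
  define x where "x = z powr (1 / (p + 2))"
  have x: "x > 0" using z by (simp add: x_def)
  \<comment> \<open>Since \<open>ln n \<le> 3 * n powr (1/3)\<close>, the unrounded level stays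
    above \<open>1 / 27\<close>. Rounding up therefore costs at most a factor 28, and
    \<open>28 ^ 3 + 1 = 21953\<close>.\<close>
  have z27: "z \<ge> 1 / 27"
  proof -
    have "L / 3 = ln (real n powr (1/3))" using n by (simp add: L_def ln_powr)
    also have "\<dots> \<le> real n powr (1/3)" using n ln_le_minus_one[of "real n powr (1/3)"] by simp
    finally have "L \<le> 3 * real n powr (1/3)" by simp
    then have "L ^ 3 \<le> (3 * real n powr (1/3)) ^ 3" using L by (intro power_mono) auto
    also have "\<dots> = 27 * (real n powr (1/3)) ^ 3" by (simp add: power_mult_distrib)
    also have "(real n powr (1/3)) ^ 3 = real n" using n by (simp add: powr_power)
    finally show ?thesis using L by (simp add: z_def field_simps)
  qed
  have x27: "x \<ge> 1 / 27"
  proof -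
    have "(1/27::real) powr 1 \<le> (1/27) powr (1 / (p + 2))" using p by (intro powr_mono') auto
    also have "\<dots> \<le> x" unfolding x_def using z27 p by (intro powr_mono2) auto
    finally show ?thesis by simp
  qed
  define k where "k = nat \<lceil>x\<rceil>"
  have k: "k \<ge> 1" "x \<le> real k" "real k \<le> 28 * x"
    using x x27 unfolding k_def by (simp_all add: le_nat_iff) linarith+
  have zx: "z = x powr (p + 2)" using z p by (simp add: x_def powr_powr)
  have "real k ^ 3 * L ^ 3 / real n = real k ^ 3 / z" using n L by (simp add: z_def)
  also have "\<dots> \<le> (28 * x) ^ 3 / z" using k z by (intro divide_right_mono power_mono) auto
  also have "\<dots> = 21952 * (x powr 3 / x powr (p + 2))"
    using x by (simp add: power_mult_distrib zx)
  also have "\<dots> = 21952 * x powr (- (p - 1))"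
    unfolding powr_diff[symmetric] by simp
  finally have 1: "real k ^ 3 * L ^ 3 / real n \<le> 21952 * x powr (- (p - 1))" .
  have 2: "real k powr (- (p - 1)) \<le> x powr (- (p - 1))"
    using k x p by (intro powr_mono2') auto
  have "x powr (- (p - 1)) = z powr (- ((p - 1) / (p + 2)))"
    using p by (simp add: x_def powr_powr minus_divide_left)
  also have "\<dots> = real n powr (- ((p - 1) / (p + 2))) / (L ^ 3) powr (- ((p - 1) / (p + 2)))"
    unfolding z_def by (rule powr_divide)
  also have "(L ^ 3) powr (- ((p - 1) / (p + 2))) = L powr (3 * (- ((p - 1) / (p + 2))))"
    using L by (simp only: powr_powr[symmetric] powr_numeral)
  also have "real n powr (- ((p - 1) / (p + 2))) / L powr (3 * (- ((p - 1) / (p + 2)))) =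
     real n powr (- ((p - 1) / (p + 2))) * L powr (3 * (p - 1) / (p + 2))"
    by (simp add: powr_minus_divide divide_simps)
  finally have "x powr (- (p - 1)) = real n powr (- ((p - 1) / (p + 2))) * L powr (3 * (p - 1) / (p + 2))" .
  with 1 2 show thesis using k(1) by (intro that[of k]) (auto simp: L_def)
qed

lemma robbins_regret_upper:
  fixes p :: real
  assumes p: "p > 1"
  shows "\<exists>C::real. C > 0 \<and> (\<forall>n::nat. n \<ge> 2 \<longrightarrow>
        (INF y0\<in>{1::enat..}. robbins_regret p n y0)
          \<le> ereal (C * real n powr (- ((p - 1) / (p + 2)))
                     * ln (real n) powr (3 * (p - 1) / (p + 2))))"
proof -
  obtain D where D: "D > 0" "\<And>G m k. G \<in> moment_class p \<Longrightarrow> m \<ge> 1 \<Longrightarrow> k \<ge> 1 \<Longrightarrow>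
    (\<Sum>y. ennreal (prior.excess G (enat k) m y)) \<le>
      ennreal (D * (real k ^ 3 * ln (real (Suc m)) ^ 3 / real (Suc m) + real k powr (- (p - 1))))"
    using suminf_excess_le[OF p] by blast
  show ?thesis
  proof (intro exI[of _ "D * 21953"] conjI allI impI)
    show "D * 21953 > 0" using D by simp
    fix n :: nat assume n: "n \<ge> 2"
    define m where "m = n - 1"
    have m: "n = Suc m" "m \<ge> 1" using n by (auto simp: m_def)
    obtain k where k: "k \<ge> 1" "real k ^ 3 * ln (real n) ^ 3 / real n + real k powr (- (p - 1)) \<le>
     21953 * (real n powr (- ((p - 1) / (p + 2))) * ln (real n) powr (3 * (p - 1) / (p + 2)))"
      using truncation_level_exists[OF p n] by blast
    let ?B = "D * 21953 * real n powr (- ((p - 1) / (p + 2))) * ln (real n) powr (3 * (p - 1) / (p + 2))"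
    have "robbins_regret p n (enat k) \<le> ereal ?B"
      unfolding m(1) robbins_regret_eq[OF p]
    proof (rule SUP_least)
      fix G assume G: "G \<in> moment_class p"
      have "(\<Sum>y. ennreal (prior.excess G (enat k) m y)) \<le>
        ennreal (D * (real k ^ 3 * ln (real n) ^ 3 / real n + real k powr (- (p - 1))))"
        using D(2)[OF G m(2) k(1)] by (simp add: m(1))
      also have "\<dots> \<le> ennreal ?B"
        using mult_left_mono[OF k(2), of D] D(1) by (intro ennreal_leI) (simp add: mult_ac)
      finally have "enn2ereal (\<Sum>y. ennreal (prior.excess G (enat k) m y)) \<le> enn2ereal (ennreal ?B)"
        by (simp add: less_eq_ennreal.rep_eq)
      also have "enn2ereal (ennreal ?B) = ereal ?B" using D(1) by (simp add: enn2ereal_ennreal)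
      finally show "enn2ereal (\<Sum>y. ennreal (prior.excess G (enat k) m y)) \<le> ereal (D * 21953 * real (Suc m) powr (- ((p - 1) / (p + 2))) * ln (real (Suc m)) powr (3 * (p - 1) / (p + 2)))"
        by (simp only: m(1))
    qed
    moreover have "enat k \<in> {1..}" using k(1) by (simp add: one_enat_def)
    ultimately show "(INF y0\<in>{1::enat..}. robbins_regret p n y0) \<le> ereal ?B"
      by (rule INF_lower2[rotated])
  qed
qed

section \<open>Lower bound\<close>

text \<open>The mixture of \<open>H\<close> with weight \<open>e\<close> and the point mass at 0
  with weight \<open>1 - e\<close>, realized by a coin toss and an independent draw from
  \<open>H\<close>.\<close>

definition zero_mix :: "real \<Rightarrow> real measure \<Rightarrow> real measure" where
  "zero_mix e H = distr (measure_pmf (bernoulli_pmf e) \<Otimes>\<^sub>M H) borel (\<lambda>x. if fst x then snd x else 0)"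

lemma nn_integral_zero_mix:
  assumes H: "prob_space H" "sets H = sets borel" and e: "0 \<le> e" "e \<le> 1"
    and [measurable]: "\<phi> \<in> borel_measurable borel"
  shows "(\<integral>\<^sup>+u. \<phi> u \<partial>zero_mix e H) = ennreal e * (\<integral>\<^sup>+u. \<phi> u \<partial>H) + ennreal (1 - e) * \<phi> 0"
proof -
  interpret H: prob_space H by fact
  note [measurable_cong] = H(2)
  have "(\<integral>\<^sup>+u. \<phi> u \<partial>zero_mix e H) =
    (\<integral>\<^sup>+x. \<phi> (if fst x then snd x else 0) \<partial>(measure_pmf (bernoulli_pmf e) \<Otimes>\<^sub>M H))"
    unfolding zero_mix_def by (rule nn_integral_distr) measurable
  also have "\<dots> = (\<integral>\<^sup>+b. \<integral>\<^sup>+u. \<phi> (if b then u else 0) \<partial>H \<partial>measure_pmf (bernoulli_pmf e))"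
    by (subst H.nn_integral_fst[symmetric]) (auto intro!: nn_integral_cong)
  also have "\<dots> = ennreal e * (\<integral>\<^sup>+u. \<phi> u \<partial>H) + ennreal (1 - e) * \<phi> 0"
    using e H.emeasure_space_1 by (simp add: mult.commute)
  finally show ?thesis .
qed

lemma sets_zero_mix [simp]: "sets (zero_mix e H) = sets borel"
  by (simp add: zero_mix_def)

text \<open>The point mass at 0 adds nothing to the p-th moment, so a small weight \<open>e\<close>
  admits components far from 0.\<close>

lemma zero_mix_moment_class:
  assumes H: "prob_space H" "sets H = sets borel" "AE u in H. 0 \<le> u" and e: "0 \<le> e" "e \<le> 1"
    and moment: "ennreal e * (\<integral>\<^sup>+u. ennreal (u powr p) \<partial>H) \<le> 1"
  shows "zero_mix e H \<in> moment_class p"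
proof -
  let ?G = "zero_mix e H"
  interpret H: prob_space H by fact
  note [measurable_cong] = H(2)
  have sp: "space ?G = UNIV" by (simp add: zero_mix_def)
  have "emeasure ?G (space ?G) = (\<integral>\<^sup>+u. 1 \<partial>?G)" by simp
  also have "\<dots> = 1"
    using e H.emeasure_space_1
    by (subst nn_integral_zero_mix[OF H(1,2) e]) (simp_all add: ennreal_plus[symmetric] del: ennreal_plus)
  finally have "prob_space ?G" by (rule prob_spaceI)
  moreover have "AE u in ?G. 0 \<le> u"
  proof -
    have "(\<integral>\<^sup>+u. indicator {..<0::real} u \<partial>H) = (\<integral>\<^sup>+u. 0 \<partial>H)"
      using H(3) by (intro nn_integral_cong_AE) (auto simp: indicator_def elim!: eventually_mono)
    then have "(\<integral>\<^sup>+u. indicator {..<0::real} u \<partial>?G) = 0"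
      using nn_integral_zero_mix[OF H(1,2) e, of "indicator {..<0::real}"] by simp
    then show ?thesis
      by (intro AE_I[of _ _ "{..<0}"]) (auto simp: not_le)
  qed
  moreover have "(\<integral>\<^sup>+u. ennreal (u powr p) \<partial>?G) \<le> 1"
    using moment nn_integral_zero_mix[OF H(1,2) e, of "\<lambda>u. ennreal (u powr p)"] by simp
  ultimately show ?thesis by (simp add: moment_class_def)
qed

text \<open>\<open>Poi(0)\<close> charges only 0, so positive observations come from the component
  \<open>H\<close>.\<close>

lemma marg_zero_mix:
  assumes H: "prob_space H" "sets H = sets borel" and e: "0 \<le> e" "e \<le> 1"
    and G: "prior (zero_mix e H)" and y: "y \<ge> 1"
    and h: "(\<integral>\<^sup>+u. ennreal (pmf (poi u) y) \<partial>H) = ennreal h" "h \<ge> 0"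
  shows "prior.marg (zero_mix e H) y = e * h"
proof -
  interpret prior "zero_mix e H" by fact
  have "pmf (poi 0) y = 0" using y by (simp add: poi_def)
  then have "ennreal (marg y) = ennreal (e * h)"
    unfolding nn_integral_pmf[symmetric]
    using e h by (subst nn_integral_zero_mix[OF H e]) (auto simp: ennreal_mult)
  then show ?thesis using e h(2) by simp
qed

text \<open>The prior lives on 0 and \<open>a = 16 * k\<close>, with the weight
  \<open>a powr (- p)\<close> that makes the moment equal to 1. A positive observation reveals
  \<theta> to be \<open>a\<close>, so returning \<open>y\<close> beyond \<open>k\<close> costs at
  least half of the Poisson variance, that is \<open>e * a / 2\<close>.\<close>

lemma regret_truncation_ge:
  fixes p :: real
  assumes p: "p > 1" and k: "k \<ge> 1"
  shows "robbins_regret p (Suc m) (enat k) \<ge> ereal (16 powr (- (p - 1)) / 2 * real k powr (- (p - 1)))"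
proof -
  define a where "a = 16 * real k"
  define e where "e = a powr (- p)"
  have a: "a \<ge> 1" using k by (simp add: a_def)
  have e: "0 \<le> e" "e \<le> 1"
    using a p powr_mono2'[of "- p" 1 a] by (auto simp: e_def)
  have e0: "e > 0" using a by (simp add: e_def)
  define H where "H = return borel a"
  have H: "prob_space H" "sets H = sets borel" "AE u in H. 0 \<le> u"
    using a unfolding H_def by (simp_all add: prob_space_return, subst AE_return) auto
  have ea: "e * a powr p = 1" using a by (simp add: e_def powr_minus)
  have G: "zero_mix e H \<in> moment_class p"
    using H e
  proof (rule zero_mix_moment_class)
    have "(\<integral>\<^sup>+u. ennreal (u powr p) \<partial>H) = ennreal (a powr p)" by (simp add: H_def nn_integral_return)
    then show "ennreal e * (\<integral>\<^sup>+u. ennreal (u powr p) \<partial>H) \<le> 1"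
      using e ea by (simp add: ennreal_mult[symmetric])
  qed
  interpret prior "zero_mix e H" by (rule prior_moment_class[OF p G])
  have marg: "marg y = e * pmf (poi a) y" if "y \<ge> 1" for y
    using marg_zero_mix[OF H(1,2) e prior_axioms that] by (simp add: H_def nn_integral_return)
  have pos: "pmf (poi a) y > 0" for y using a by (simp add: pmf_poi)
  have bayes: "bayes y = a" if "y \<ge> 1" for y
  proof -
    have "bayes y = real (y + 1) * pmf (poi a) (y + 1) / pmf (poi a) y"
      using e0 that by (simp add: bayes_def marg)
    also have "\<dots> = a" using a pos[of y] by (subst pmf_poi_Suc) auto
    finally show ?thesis .
  qed
  have "ennreal (e * (a / 2)) = ennreal e * ennreal (a / 2)" using e a by (intro ennreal_mult) auto
  also have "\<dots> \<le> ennreal e * (\<Sum>y. ennreal (if y > k then (real y - a)\<^sup>2 * pmf (poi a) y else 0))"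
    using poi_square_tail_ge[OF k] unfolding a_def by (intro mult_left_mono) auto
  also have "\<dots> = (\<Sum>y. ennreal e * ennreal (if y > k then (real y - a)\<^sup>2 * pmf (poi a) y else 0))"
    by (rule ennreal_suminf_cmult[symmetric])
  also have "\<dots> \<le> (\<Sum>y. ennreal (excess (enat k) m y))"
  proof (intro suminf_le)
    fix y
    show "ennreal e * ennreal (if y > k then (real y - a)\<^sup>2 * pmf (poi a) y else 0) \<le> ennreal (excess (enat k) m y)"
    proof (cases "y > k")
      case True
      then have "excess (enat k) m y = e * ((real y - a)\<^sup>2 * pmf (poi a) y)"
        using k by (simp add: excess_def marg bayes)
      then show ?thesis using True e by (simp add: ennreal_mult)
    qed auto
  qed auto
  finally have "enn2ereal (ennreal (e * (a / 2))) \<le> enn2ereal (\<Sum>y. ennreal (excess (enat k) m y))"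
    by (simp add: less_eq_ennreal.rep_eq)
  also have "\<dots> \<le> robbins_regret p (Suc m) (enat k)"
    unfolding robbins_regret_eq[OF p] by (rule SUP_upper[OF G])
  also have "enn2ereal (ennreal (e * (a / 2))) = ereal (e * (a / 2))"
    using e a by (simp add: enn2ereal_ennreal)
  also have "e * (a / 2) = 16 powr (- (p - 1)) / 2 * real k powr (- (p - 1))"
  proof -
    have "e * a = a powr (- (p - 1))" using a powr_add[of a "- p" 1] by (simp add: e_def)
    also have "\<dots> = 16 powr (- (p - 1)) * real k powr (- (p - 1))" unfolding a_def by (rule powr_mult)
    finally show ?thesis by simp
  qed
  finally show ?thesis .
qed

text \<open>Gamma-Poisson conjugacy: exponential density times Poisson mass is a multiple of an
  Erlang density, so the mixture is geometric.\<close>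

lemma nn_integral_pmf_poi_exponential:
  assumes l: "l > 0"
  shows "(\<integral>\<^sup>+u. ennreal (pmf (poi u) y) \<partial>density lborel (\<lambda>t. ennreal (erlang_density 0 l t)))
    = ennreal (l / (1 + l) ^ (y + 1))"
proof -
  have "(\<integral>\<^sup>+u. ennreal (pmf (poi u) y) \<partial>density lborel (\<lambda>t. ennreal (erlang_density 0 l t))) =
    (\<integral>\<^sup>+t. ennreal (erlang_density 0 l t) * ennreal (pmf (poi t) y) \<partial>lborel)"
    by (rule nn_integral_density) auto
  also have "\<dots> = (\<integral>\<^sup>+t. ennreal (l / (1 + l) ^ (y + 1)) * ennreal (erlang_density y (1 + l) t) \<partial>lborel)"
  proof (rule nn_integral_cong)
    fix t :: real
    have "erlang_density 0 l t * pmf (poi t) y = l / (1 + l) ^ (y + 1) * erlang_density y (1 + l) t"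
    proof (cases "t < 0")
      case False
      have "exp (- (l * t)) * exp (- t) = exp ((- 1 - l) * t)"
        by (simp add: exp_add[symmetric] algebra_simps)
      then show ?thesis using False l by (simp add: erlang_density_def pmf_poi)
    qed (simp add: erlang_density_def)
    then show "ennreal (erlang_density 0 l t) * ennreal (pmf (poi t) y) =
        ennreal (l / (1 + l) ^ (y + 1)) * ennreal (erlang_density y (1 + l) t)"
      using l by (simp add: ennreal_mult''[symmetric])
  qed
  also have "\<dots> = ennreal (l / (1 + l) ^ (y + 1)) * (\<integral>\<^sup>+t. ennreal (erlang_density y (1 + l) t) \<partial>lborel)"
    by (rule nn_integral_cmult) auto
  also have "(\<integral>\<^sup>+t. ennreal (erlang_density y (1 + l) t) \<partial>lborel) = 1"
    using nn_integral_erlang_ith_moment[of "1 + l" y 0] l by simp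
  finally show ?thesis by simp
qed

text \<open>After rescaling by the rate, the real power is at most \<open>1 + (l * t) ^ j\<close>,
  which reduces the claim to integer moments.\<close>

lemma nn_integral_powr_exponential_le:
  fixes p :: real
  assumes l: "l > 0" and p: "0 \<le> p" "p \<le> real j"
  shows "(\<integral>\<^sup>+u. ennreal (u powr p) \<partial>density lborel (\<lambda>t. ennreal (erlang_density 0 l t)))
    \<le> ennreal ((1 / l) powr p * (1 + fact j))"
proof -
  have int: "(\<integral>\<^sup>+t. ennreal (erlang_density 0 l t * t ^ i) \<partial>lborel) = ennreal (fact i / l ^ i)" for i
    using nn_integral_erlang_ith_moment[OF l, of 0 i] by simp
  have "(\<integral>\<^sup>+u. ennreal (u powr p) \<partial>density lborel (\<lambda>t. ennreal (erlang_density 0 l t))) =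
    (\<integral>\<^sup>+t. ennreal (erlang_density 0 l t) * ennreal (t powr p) \<partial>lborel)"
    by (rule nn_integral_density) auto
  also have "\<dots> \<le> (\<integral>\<^sup>+t. ennreal ((1 / l) powr p) * (ennreal (erlang_density 0 l t * t ^ 0) + ennreal (l ^ j) * ennreal (erlang_density 0 l t * t ^ j)) \<partial>lborel)"
  proof (rule nn_integral_mono)
    fix t :: real
    show "ennreal (erlang_density 0 l t) * ennreal (t powr p) \<le>
      ennreal ((1 / l) powr p) * (ennreal (erlang_density 0 l t * t ^ 0) + ennreal (l ^ j) * ennreal (erlang_density 0 l t * t ^ j))"
    proof (cases "t < 0")
      case False
      have "t powr p = (1 / l) powr p * (l * t) powr p"
        using l False by (subst powr_mult[symmetric]) auto
      also have "(l * t) powr p \<le> 1 + (l * t) ^ j"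
      proof (cases "l * t \<le> 1")
        case True
        then have "(l * t) powr p \<le> 1 powr p" using False l p by (intro powr_mono2) auto
        then show ?thesis using False l by (simp add: add_increasing2)
      next
        case ge: False
        then have "(l * t) powr p \<le> (l * t) powr real j" using p by (intro powr_mono) auto
        then show ?thesis using ge by (simp add: powr_realpow)
      qed
      finally have "erlang_density 0 l t * t powr p \<le>
          erlang_density 0 l t * ((1 / l) powr p * (1 + (l * t) ^ j))"
        using l by (intro mult_left_mono) (auto simp: mult_left_mono)
      also have "\<dots> = (1 / l) powr p * (erlang_density 0 l t * t ^ 0 + l ^ j * (erlang_density 0 l t * t ^ j))"
        by (simp add: power_mult_distrib algebra_simps)
      finally have "ennreal (erlang_density 0 l t * t powr p) \<le>
         ennreal ((1 / l) powr p * (erlang_density 0 l t * t ^ 0 + l ^ j * (erlang_density 0 l t * t ^ j)))"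
        by (rule ennreal_leI)
      then show ?thesis using l False by (simp add: ennreal_mult ennreal_plus)
    qed (simp add: erlang_density_def)
  qed
  also have "\<dots> = ennreal ((1 / l) powr p) * (ennreal (fact 0 / l ^ 0) + ennreal (l ^ j) * ennreal (fact j / l ^ j))"
    unfolding int[symmetric] by (simp add: nn_integral_cmult nn_integral_add)
  also have "\<dots> = ennreal ((1 / l) powr p * (1 + fact j))"
    using l by (simp add: ennreal_mult ennreal_plus ennreal_mult[symmetric])
  finally show ?thesis .
qed

section \<open>Contribution of the conditional variance under a geometric marginal\<close>

lemma sum_squares_ge: "real K ^ 3 / 3 \<le> (\<Sum>y = 1..K. (real (y + 1))\<^sup>2)"
proof (induction K)
  case (Suc K)
  have "real (Suc K) ^ 3 / 3 \<le> real K ^ 3 / 3 + (real (Suc K + 1))\<^sup>2"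
    by (simp add: power3_eq_cube power2_eq_square algebra_simps)
  then show ?case using Suc by simp
qed simp

text \<open>Monotonicity of \<open>(1 + x) * exp (- x)\<close>, the Poisson probability of at most
  one event, from \<open>1 + x \<le> (1 + x0) * (1 + (x - x0))\<close>.\<close>

lemma one_plus_times_exp_minus_le:
  fixes x x0 :: real
  assumes "0 < x0" "x0 \<le> x"
  shows "(1 + x) * exp (- x) \<le> (1 + x0) * exp (- x0)"
proof -
  have "1 + x \<le> (1 + x0) * (1 + (x - x0))"
    using mult_nonneg_nonneg[of x0 "x - x0"] assms by (simp add: algebra_simps)
  also have "\<dots> \<le> (1 + x0) * exp (x - x0)"
    using assms exp_ge_add_one_self[of "x - x0"] by (intro mult_left_mono) auto
  finally have "(1 + x) * exp (- x) \<le> (1 + x0) * exp (x - x0) * exp (- x)"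
    by (intro mult_right_mono) auto
  also have "\<dots> = (1 + x0) * exp (- x0)" by (simp add: mult.assoc exp_add[symmetric])
  finally show ?thesis .
qed

lemma one_plus_times_exp_minus_less:
  fixes x :: real
  assumes "0 < x"
  shows "(1 + x) * exp (- x) < 1"
proof -
  have "1 + x < 1 + x + x\<^sup>2 / 2" using assms by simp
  also have "\<dots> \<le> exp x" using exp_lower_Taylor_quadratic[of x] assms by simp
  finally have "(1 + x) * exp (- x) < exp x * exp (- x)" by (intro mult_strict_right_mono) auto
  then show ?thesis by (simp add: exp_add[symmetric])
qed

text \<open>The probability of at most one success in \<open>m + 1\<close> trials equals
  \<open>(1 + m * x) * (1 - x) ^ m\<close>, and \<open>1 - x \<le> exp (- x)\<close> compares it
  with the Poisson case.\<close>

lemma binomial_two_successes_ge: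
  fixes x x0 :: real
  assumes x: "0 \<le> x" "x \<le> 1" and x0: "0 < x0" "x0 \<le> real m * x"
  shows "1 - (1 + x0) * exp (- x0) \<le> 1 - (1 - x) ^ (m + 1) - real (m + 1) * x * (1 - x) ^ m"
proof -
  have "(1 - x) ^ (m + 1) + real (m + 1) * x * (1 - x) ^ m = (1 + real m * x) * (1 - x) ^ m"
    by (simp add: algebra_simps)
  also have "\<dots> \<le> (1 + real m * x) * exp (- x) ^ m"
    using x exp_ge_add_one_self[of "- x"] by (intro mult_left_mono power_mono) auto
  also have "exp (- x) ^ m = exp (- (real m * x))" by (simp add: exp_of_nat_mult[symmetric])
  also have "(1 + real m * x) * exp (- (real m * x)) \<le> (1 + x0) * exp (- x0)"
    by (rule one_plus_times_exp_minus_le[OF x0])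
  finally show ?thesis by simp
qed

text \<open>The exponential component has mean \<open>K\<close> and weight of order
  \<open>K powr (- p)\<close>. The bound on \<open>K\<close> keeps the marginal at least of order
  \<open>1 / n\<close> on \<open>{1..K}\<close>, so two successes have probability at least
  \<open>d\<close>. Each such \<open>y\<close> then contributes \<open>(y + 1)\<^sup>2\<close> times
  \<open>d / (3 * n)\<close>.\<close>

lemma regret_variance_ge:
  fixes p :: real
  assumes p: "p > 1"
  obtains c where "c > 0" "\<And>m K y0. m \<ge> 1 \<Longrightarrow> K \<ge> 1 \<Longrightarrow> enat K \<le> y0 \<Longrightarrow>
     real K powr (p + 1) \<le> 4 * real (Suc m) \<Longrightarrow>
     robbins_regret p (Suc m) y0 \<ge> ereal (c * real K ^ 3 / real (Suc m))"
proof -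
  define j where "j = nat \<lceil>p\<rceil>"
  have j: "p \<le> real j" using p by (simp add: j_def)
  \<comment> \<open>The constant bounds the moment by \<open>1 / 4\<close> and gives
    \<open>e \<le> 1 / 4\<close>. With \<open>x0\<close> as below, the marginal is at least
    \<open>2 * x0 / n\<close>, and \<open>m \<ge> n / 2\<close> yields
    \<open>x0 \<le> m * marg y\<close>.\<close>
  define M where "M = 4 * (1 + fact j :: real)"
  have M: "M > 0" "M \<ge> 4" by (simp_all add: M_def add_pos_nonneg)
  define x0 where "x0 = 1 / (48 * M)"
  have x0: "x0 > 0" using M by (simp add: x0_def)
  define d where "d = 1 - (1 + x0) * exp (- x0)"
  have d: "d > 0" using one_plus_times_exp_minus_less[OF x0] by (simp add: d_def)
  show thesis
  proof (rule that)
    show "d / 9 > 0" using d by simp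
    fix m K y0 assume m: "m \<ge> 1" and K: "K \<ge> 1" "enat K \<le> y0" and Kn: "real K powr (p + 1) \<le> 4 * real (Suc m)"
    define l where "l = 1 / real K"
    have l: "0 < l" "l \<le> 1" using K by (simp_all add: l_def)
    define e where "e = 1 / (M * real K powr p)"
    have Kp: "1 \<le> real K powr p" using K p by (intro ge_one_powr_ge_zero) auto
    have e: "0 < e" "e \<le> 1 / 4"
    proof -
      have "4 * 1 \<le> M * real K powr p" using Kp M by (intro mult_mono) auto
      then show "0 < e" "e \<le> 1/4" using M Kp unfolding e_def by (auto simp: field_simps)
    qed
    define H where "H = density lborel (\<lambda>t. ennreal (erlang_density 0 l t))"
    have H: "prob_space H" "sets H = sets borel" "AE u in H. 0 \<le> u"
      using prob_space_erlang_density[OF l(1), of 0] unfolding H_def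
      by (auto simp: AE_density erlang_density_def)
    have e': "0 \<le> e" "e \<le> 1" using e by auto
    have G: "zero_mix e H \<in> moment_class p"
      using H e'
    proof (rule zero_mix_moment_class)
      have "ennreal e * (\<integral>\<^sup>+u. ennreal (u powr p) \<partial>H) \<le> ennreal e * ennreal ((1 / l) powr p * (1 + fact j))"
        unfolding H_def using p j by (intro mult_left_mono nn_integral_powr_exponential_le l) auto
      also have "\<dots> = ennreal (e * (real K powr p * (1 + fact j)))"
        using e by (simp add: ennreal_mult[symmetric] l_def)
      also have "e * (real K powr p * (1 + fact j)) = 1 / 4"
        using Kp M K by (simp add: e_def M_def)
      finally show "ennreal e * (\<integral>\<^sup>+u. ennreal (u powr p) \<partial>H) \<le> 1"
        by (rule order_trans) (simp add: ennreal_le_1)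
    qed
    interpret prior "zero_mix e H" by (rule prior_moment_class[OF p G])
    have marg: "marg y = e * (l / (1 + l) ^ (y + 1))" if "y \<ge> 1" for y
      using l unfolding H_def
      by (intro marg_zero_mix[OF H(1,2)[unfolded H_def] e' prior_axioms[unfolded H_def] that nn_integral_pmf_poi_exponential]) auto
    define n where "n = real (Suc m)"
    have n: "n \<ge> 2" using m by (simp add: n_def)
    have summand: "d / (3 * n) * (real (y + 1))\<^sup>2 \<le> excess y0 m y" if y: "1 \<le> y" "y \<le> K" for y
    proof -
      let ?x = "marg y" and ?y = "marg (y + 1)"
      have xpos: "?x > 0" using y l e by (simp add: marg)
      have le4: "marg z \<le> 1 / 4" if "z \<ge> 1" for z
      proof -
        have "l / (1 + l) ^ (z + 1) \<le> 1 / 1" using l by (intro frac_le one_le_power) auto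
        then have "e * (l / (1 + l) ^ (z + 1)) \<le> 1 / 4 * 1" using e l by (intro mult_mono) auto
        then show ?thesis using that by (simp add: marg)
      qed
      have r: "?y / ?x \<ge> 1 / 2"
      proof -
        have "?y / ?x = 1 / (1 + l)" using y l e by (simp add: marg)
        also have "\<dots> \<ge> 1 / 2" using l by (intro frac_le) auto
        finally show ?thesis .
      qed
      have q: "?y / (1 - ?x) \<le> 1 / 3"
      proof -
        have "?y / (1 - ?x) \<le> (1 / 4) / (3 / 4)" using le4[of y] le4[of "y + 1"] y by (intro frac_le) auto
        then show ?thesis by simp
      qed
      have xge: "?x \<ge> 2 * x0 / n"
      proof -
        \<comment> \<open>As \<open>l = 1 / K\<close>, the geometric decay up to \<open>K\<close>
          costs only the bounded factor \<open>2 * exp 1 \<le> 6\<close>.\<close>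
        have "(1 + l) ^ (y + 1) \<le> (1 + l) ^ (K + 1)" using l y by (intro power_increasing) auto
        also have "\<dots> = (1 + l) ^ K * (1 + l)" by simp
        also have "\<dots> \<le> exp 1 * 2"
        proof (intro mult_mono)
          have "(1 + l) ^ K \<le> exp l ^ K" using l exp_ge_add_one_self[of l] by (intro power_mono) auto
          also have "\<dots> = exp 1" using K by (simp add: exp_of_nat_mult[symmetric] l_def)
          finally show "(1 + l) ^ K \<le> exp 1" .
        qed (use l in auto)
        also have "\<dots> \<le> 6" using exp_le by simp
        finally have "l / 6 \<le> l / (1 + l) ^ (y + 1)" using l by (intro divide_left_mono) auto
        then have "e * (l / 6) \<le> ?x"
          unfolding marg[OF y(1)] using e by (intro mult_left_mono) auto
        have Kpow: "real K powr p * real K = real K powr (p + 1)" using K by (simp add: powr_add)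
        have "e * (l / 6) = 1 / (6 * M * (real K powr p * real K))" by (simp add: e_def l_def)
        also have "\<dots> \<ge> 1 / (6 * M * (4 * n))"
          unfolding Kpow using M K Kn n by (intro divide_left_mono mult_left_mono mult_pos_pos) (auto simp: n_def)
        finally show ?thesis using \<open>e * (l / 6) \<le> ?x\<close> by (simp add: x0_def)
      qed
      have mx: "x0 \<le> real m * ?x"
      proof -
        have "x0 = n / 2 * (2 * x0 / n)" using n by simp
        also have "\<dots> \<le> real m * ?x" using xge x0 n m by (intro mult_mono) (auto simp: n_def)
        finally show ?thesis .
      qed
      \<comment> \<open>The factor \<open>1 / 2\<close> bounds the ratio of consecutive marginals,
        \<open>2 / 3\<close> bounds \<open>1 - q\<close>.\<close>
      have "d / (3 * n) = (1 / 2) * (2 / 3) / n * d" by simp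
      also have "\<dots> \<le> ?y / ?x * (1 - ?y / (1 - ?x)) / real (m + 1)
          * (1 - (1 - ?x) ^ (m + 1) - real (m + 1) * ?x * (1 - ?x) ^ m)"
      proof (rule mult_mono)
        have "1 / 2 * (2 / 3) \<le> ?y / ?x * (1 - ?y / (1 - ?x))" using r q by (intro mult_mono) auto
        then have "1 / 2 * (2 / 3) / n \<le> ?y / ?x * (1 - ?y / (1 - ?x)) / n"
          using n by (intro divide_right_mono) auto
        then show "1 / 2 * (2 / 3) / n \<le> ?y / ?x * (1 - ?y / (1 - ?x)) / real (m + 1)"
          by (simp only: n_def Suc_eq_plus1)
        have "0 \<le> 1 - ?y / (1 - ?x)" using q by linarith
        then have "0 \<le> ?y / ?x * (1 - ?y / (1 - ?x))" by (intro mult_nonneg_nonneg) auto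
        then show "0 \<le> ?y / ?x * (1 - ?y / (1 - ?x)) / real (m + 1)"
          by (rule divide_nonneg_nonneg) simp
        show "d \<le> 1 - (1 - ?x) ^ (m + 1) - real (m + 1) * ?x * (1 - ?x) ^ m"
          unfolding d_def using x0 mx le4[of y] y by (intro binomial_two_successes_ge) auto
      qed (use d in simp)
      also have "\<dots> \<le> ?x * ratio_risk m ?x ?y"
        using xpos le4[of y] y marg_pair_le[of y "y + 1"] by (intro ratio_risk_ge) auto
      finally have "d / (3 * n) * (real (y + 1))\<^sup>2 \<le> ?x * ratio_risk m ?x ?y * (real (y + 1))\<^sup>2"
        by (intro mult_right_mono) auto
      moreover have "enat y \<le> y0" using y K(2) by (meson enat_ord_simps(1) order_trans)
      ultimately show ?thesis by (simp add: excess_def mult_ac)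
    qed
    have "d / 9 * real K ^ 3 / n = d / (3 * n) * (real K ^ 3 / 3)" by simp
    also have "\<dots> \<le> d / (3 * n) * (\<Sum>y = 1..K. (real (y + 1))\<^sup>2)"
      using d n by (intro mult_left_mono sum_squares_ge) auto
    also have "\<dots> \<le> (\<Sum>y = 1..K. excess y0 m y)"
      unfolding sum_distrib_left by (intro sum_mono summand) auto
    finally have "ennreal (d / 9 * real K ^ 3 / n) \<le> (\<Sum>y = 1..K. ennreal (excess y0 m y))"
      by (subst sum_ennreal) (auto intro: ennreal_leI excess_nonneg)
    also have "\<dots> \<le> (\<Sum>y. ennreal (excess y0 m y))"
      by (rule sum_le_suminf) auto
    finally have "enn2ereal (ennreal (d / 9 * real K ^ 3 / n)) \<le> enn2ereal (\<Sum>y. ennreal (excess y0 m y))"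
      by (simp add: less_eq_ennreal.rep_eq)
    also have "\<dots> \<le> robbins_regret p (Suc m) y0"
      unfolding robbins_regret_eq[OF p] by (rule SUP_upper[OF G])
    also have "enn2ereal (ennreal (d / 9 * real K ^ 3 / n)) = ereal (d / 9 * real K ^ 3 / n)"
      using d n by (intro enn2ereal_ennreal) auto
    finally show "ereal (d / 9 * real K ^ 3 / real (Suc m)) \<le> robbins_regret p (Suc m) y0"
      by (simp add: n_def)
  qed
qed

section \<open>Rates\<close>

lemma ln_ge_half: "n \<ge> 2 \<Longrightarrow> ln (real n) \<ge> 1 / 2"
proof -
  assume n: "n \<ge> 2"
  have "1/2 \<le> ln (2::real)" using ln2_ge_two_thirds by simp
  also have "\<dots> \<le> ln (real n)" using n by simp
  finally show ?thesis .
qed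

text \<open>With \<open>s = sqrt n\<close>, the inequality
  \<open>ln s \<le> s / exp 1 \<le> s / 2\<close> gives \<open>ln n \<le> sqrt n\<close>.\<close>

lemma y_star_ge_one:
  assumes "p > 1" "n \<ge> 2"
  shows "y_star p n \<ge> 1"
proof -
  define s where "s = sqrt (real n)"
  have s: "s > 0" "s\<^sup>2 = real n" using assms by (simp_all add: s_def)
  have e: "exp 1 \<ge> (2::real)" using exp_ge_add_one_self[of 1] by simp
  have "ln s \<le> exp (ln s - 1)" using exp_ge_add_one_self[of "ln s - 1"] by simp
  also have "\<dots> = s / exp 1" using s by (simp add: exp_diff)
  also have "\<dots> \<le> s / 2" using s e by (intro divide_left_mono) auto
  finally have "ln (real n) \<le> s" using s(1) by (simp add: s(2)[symmetric] ln_realpow)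
  then have "(ln (real n))\<^sup>2 \<le> s\<^sup>2" using ln_ge_half[OF assms(2)] by (intro power_mono) auto
  then have "1 \<le> real n / (ln (real n))\<^sup>2" using s ln_ge_half[OF assms(2)] by simp
  then show ?thesis unfolding y_star_def using assms(1) by (intro ge_one_powr_ge_zero) auto
qed

lemma y_star_powr:
  assumes "p > 1" "n \<ge> 2"
  shows "y_star p n powr (p + 1) = real n / (ln (real n))\<^sup>2"
  using assms ln_ge_half[OF assms(2)] by (simp add: y_star_def powr_powr)

text \<open>The logarithm is absorbed by \<open>ln n \<le> a * n powr (1 / a)\<close> with
  \<open>a = 2 * (p + 2)\<close>. This exponent is chosen so that the remaining power of
  \<open>n\<close> is exactly \<open>1 / (p + 2)\<close>, the optimal truncation scale.\<close>

lemma y_star_ge: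
  assumes "p > 1" "n \<ge> 2"
  shows "y_star p n \<ge> real n powr (1 / (p + 2)) / (2 * (p + 2))\<^sup>2"
proof -
  define a where "a = 2 * (p + 2)"
  define L where "L = ln (real n)"
  have a: "a \<ge> 1" using assms by (simp add: a_def)
  have L: "L > 0" using ln_ge_half[OF assms(2)] by (simp add: L_def)
  have n: "real n > 0" using assms by simp
  have "L / a = ln (real n powr (1 / a))" using n by (simp add: ln_powr L_def)
  also have "\<dots> \<le> real n powr (1 / a)" using n ln_le_minus_one[of "real n powr (1 / a)"] by simp
  finally have "L \<le> a * real n powr (1 / a)" using a by (simp add: field_simps)
  then have "L\<^sup>2 \<le> (a * real n powr (1 / a))\<^sup>2" using L by (intro power_mono) auto
  also have "\<dots> = a\<^sup>2 * real n powr (1 / (p + 2))"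
  proof -
    have "2 / (2 * p + 4) = 1 / (p + 2)" using assms(1) by (simp add: field_simps)
    then show ?thesis using assms(1) n by (simp add: power_mult_distrib powr_power a_def)
  qed
  finally have L2: "L\<^sup>2 \<le> a\<^sup>2 * real n powr (1 / (p + 2))" .
  have "(1 / a\<^sup>2) * real n powr ((p + 1) / (p + 2)) = real n / (a\<^sup>2 * real n powr (1 / (p + 2)))"
  proof -
    have "(p + 1) / (p + 2) = 1 - 1 / (p + 2)" using assms(1) by (simp add: field_simps)
    then show ?thesis using n by (simp add: powr_diff)
  qed
  also have "\<dots> \<le> real n / L\<^sup>2" using L2 L n a by (intro divide_left_mono mult_pos_pos) auto
  finally have "((1 / a\<^sup>2) * real n powr ((p + 1) / (p + 2))) powr (1 / (p + 1)) \<le> y_star p n"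
    unfolding y_star_def L_def[symmetric] using assms(1) by (intro powr_mono2) auto
  moreover have "((1 / a\<^sup>2) * real n powr ((p + 1) / (p + 2))) powr (1 / (p + 1)) =
      (1 / a\<^sup>2) powr (1 / (p + 1)) * real n powr (1 / (p + 2))"
    unfolding powr_mult powr_powr using assms(1) by simp
  moreover have "(1 / a\<^sup>2) powr 1 \<le> (1 / a\<^sup>2) powr (1 / (p + 1))"
    using a assms(1) by (intro powr_mono') auto
  then have "(1 / a\<^sup>2) * real n powr (1 / (p + 2)) \<le> (1 / a\<^sup>2) powr (1 / (p + 1)) * real n powr (1 / (p + 2))"
    by (intro mult_right_mono) auto
  ultimately show ?thesis by (simp add: a_def)
qed

text \<open>The two terms come from two different priors; since the regret is a supremum it
  dominates their maximum, hence half of their sum.\<close>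

lemma robbins_regret_lower:
  fixes p :: real
  assumes p: "p > 1"
  obtains c where "c > 0" "\<And>n y0. n \<ge> 2 \<Longrightarrow> y0 \<ge> 1 \<Longrightarrow>
    robbins_regret p n y0 \<ge> ereal (c * (enat_min_real y0 (y_star p n) ^ 3 / real n + enat_powr_minus y0 (p - 1)))"
proof -
  obtain c where c: "c > 0" "\<And>m K y0. m \<ge> 1 \<Longrightarrow> K \<ge> 1 \<Longrightarrow> enat K \<le> y0 \<Longrightarrow>
     real K powr (p + 1) \<le> 4 * real (Suc m) \<Longrightarrow>
     robbins_regret p (Suc m) y0 \<ge> ereal (c * real K ^ 3 / real (Suc m))"
    using regret_variance_ge[OF p] by blast
  define c' where "c' = (16::real) powr (- (p - 1)) / 2"
  \<comment> \<open>The 8 pays for rounding \<open>w\<close> down to \<open>K\<close>, as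
    \<open>w \<le> 2 * K\<close>; the 2 pays for passing from the maximum to the sum.\<close>
  define d where "d = min (c / 8) c' / 2"
  have c': "c' > 0" by (simp add: c'_def)
  have d: "d > 0" "2 * d \<le> c / 8" "2 * d \<le> c'" using c(1) c' by (auto simp: d_def)
  show thesis
  proof (rule that[OF d(1)])
    fix n y0 assume n: "n \<ge> (2::nat)" and y0: "y0 \<ge> (1::enat)"
    define m where "m = n - 1"
    have m: "n = Suc m" "m \<ge> 1" using n by (auto simp: m_def)
    define w where "w = enat_min_real y0 (y_star p n)"
    have w: "1 \<le> w" "w \<le> y_star p n" "\<And>k. y0 = enat k \<Longrightarrow> w \<le> real k"
      using y0 y_star_ge_one[OF p n]
      by (auto simp: w_def enat_min_real_def one_enat_def split: enat.splits)
    define K where "K = nat \<lfloor>w\<rfloor>"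
    have K: "1 \<le> K" "real K \<le> w" "w \<le> 2 * real K"
    proof -
      have "1 \<le> \<lfloor>w\<rfloor>" using w(1) by simp
      then have "(1::real) \<le> real_of_int \<lfloor>w\<rfloor>" "real K = real_of_int \<lfloor>w\<rfloor>"
        by (simp_all add: K_def del: one_le_floor)
      then show "1 \<le> K" "real K \<le> w" "w \<le> 2 * real K" using floor_correct[of w] by linarith+
    qed
    have "enat K \<le> y0"
    proof (cases y0)
      case (enat k)
      then have "real K \<le> real k" using w(3) K(2) by force
      then show ?thesis using enat by simp
    qed simp
    moreover have "real K powr (p + 1) \<le> 4 * real n"
    proof -
      have "real K powr (p + 1) \<le> y_star p n powr (p + 1)"
        using K w p by (intro powr_mono2) auto
      also have "\<dots> = real n / (ln (real n))\<^sup>2" by (rule y_star_powr[OF p n])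
      \<comment> \<open>The factor 4 in the hypothesis of \<open>regret_variance_ge\<close> stems
        from \<open>ln n \<ge> 1/2\<close>.\<close>
      also have "\<dots> \<le> real n / (1 / 2)\<^sup>2"
        using ln_ge_half[OF n] by (intro divide_left_mono power_mono mult_pos_pos) auto
      finally show ?thesis by (simp add: power2_eq_square)
    qed
    ultimately have 1: "ereal (c * real K ^ 3 / real n) \<le> robbins_regret p n y0"
      using c(2)[OF m(2) K(1)] unfolding m(1) by blast
    have 11: "2 * d * (w ^ 3 / real n) \<le> c * real K ^ 3 / real n"
    proof -
      have "2 * d * w ^ 3 \<le> c / 8 * (2 * real K) ^ 3" using d K w by (intro mult_mono power_mono) auto
      also have "\<dots> = c * real K ^ 3" by (simp add: power_mult_distrib)
      finally show ?thesis using n by (simp add: divide_right_mono)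
    qed
    have "ereal (2 * d * enat_powr_minus y0 (p - 1)) \<le> robbins_regret p n y0"
    proof (cases y0)
      case (enat k)
      then have k: "k \<ge> 1" using y0 by (simp add: one_enat_def)
      have "2 * d * real k powr (- (p - 1)) \<le> c' * real k powr (- (p - 1))"
        using d by (intro mult_right_mono) auto
      then have "ereal (2 * d * real k powr (- (p - 1))) \<le> ereal (c' * real k powr (- (p - 1)))" by simp
      also have "\<dots> \<le> robbins_regret p n y0"
        unfolding enat m(1) c'_def by (rule regret_truncation_ge[OF p k])
      finally show ?thesis by (simp add: enat enat_powr_minus_def)
    next
      \<comment> \<open>Without truncation the second term is 0, and the regret is nonnegative by
        the first bound.\<close>
      case infinity
      have "0 \<le> c * real K ^ 3 / real n" using c(1) by simp
      then show ?thesis using 1 order_trans[of 0 "ereal (c * real K ^ 3 / real n)"]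
        by (simp add: infinity enat_powr_minus_def zero_ereal_def)
    qed
    moreover have "ereal (2 * d * (w ^ 3 / real n)) \<le> robbins_regret p n y0"
      using 1 11 order_trans[of "ereal (2 * d * (w ^ 3 / real n))" "ereal (c * real K ^ 3 / real n)"] by simp
    moreover have "d * (a + b) \<le> max (2 * d * a) (2 * d * b)" for a b
    proof (cases "a \<le> b")
      case True
      then have "d * (a + b) \<le> d * (b + b)" using d by (intro mult_left_mono) auto
      then show ?thesis by simp
    next
      case False
      then have "d * (a + b) \<le> d * (a + a)" using d by (intro mult_left_mono) auto
      then show ?thesis by simp
    qed
    ultimately have "ereal (d * (w ^ 3 / real n + enat_powr_minus y0 (p - 1))) \<le> robbins_regret p n y0"
      by (smt (verit) ereal_less_eq(3) max_def order_trans)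
    then show "ereal (d * (enat_min_real y0 (y_star p n) ^ 3 / real n + enat_powr_minus y0 (p - 1))) \<le> robbins_regret p n y0"
      by (simp add: w_def)
  qed
qed

text \<open>The exact power of the logarithm in \<open>y_star p n ^ 3 / n\<close> is
  \<open>- (6 / (p + 1))\<close>. Passing to \<open>- 6\<close> costs at most \<open>2 ^ 6\<close>
  because \<open>ln n \<ge> 1/2\<close>.\<close>

lemma untruncated_rate_le:
  fixes p :: real
  assumes p: "p > 1" and n: "n \<ge> 2"
  shows "real n powr (- ((p - 2) / (p + 1))) * ln (real n) powr (- 6) \<le> 64 * (y_star p n ^ 3 / real n)"
proof -
  define L where "L = ln (real n)"
  have L: "L \<ge> 1 / 2" using ln_ge_half[OF n] by (simp add: L_def)
  have n0: "real n > 0" using n by simp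
  have ys: "y_star p n ^ 3 / real n = real n powr (- ((p - 2) / (p + 1))) * L powr (- (6 / (p + 1)))"
  proof -
    have "y_star p n ^ 3 = (real n / L\<^sup>2) powr (3 / (p + 1))"
      using n0 L by (simp add: y_star_def L_def[symmetric] powr_power)
    also have "\<dots> = real n powr (3 / (p + 1)) / (L\<^sup>2) powr (3 / (p + 1))" by (rule powr_divide)
    also have "(L\<^sup>2) powr (3 / (p + 1)) = L powr (6 / (p + 1))"
      using L by (simp add: powr_numeral[symmetric] powr_powr del: powr_numeral)
    also have "real n powr (3 / (p + 1)) / L powr (6 / (p + 1)) / real n =
        (real n powr (3 / (p + 1)) / real n powr 1) * L powr (- (6 / (p + 1)))"
      using n0 by (simp add: powr_minus_divide)
    also have "real n powr (3 / (p + 1)) / real n powr 1 = real n powr (- ((p - 2) / (p + 1)))"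
    proof -
      have "3 / (p + 1) - 1 = - ((p - 2) / (p + 1))" using p by (simp add: field_simps)
      then show ?thesis unfolding powr_diff[symmetric] by simp
    qed
    finally show ?thesis .
  qed
  have "L powr (- 6) \<le> 64 * L powr (- (6 / (p + 1)))"
  proof -
    have "(1/2) powr 6 \<le> (1 / 2 :: real) powr (6 - 6 / (p + 1))"
      using p by (intro powr_mono') auto
    also have "\<dots> \<le> L powr (6 - 6 / (p + 1))" using L p by (intro powr_mono2) (auto simp: field_simps)
    finally have "1 \<le> 64 * L powr (6 - 6 / (p + 1))" by (simp add: power_divide)
    then have "L powr (- 6) * 1 \<le> L powr (- 6) * (64 * L powr (6 - 6 / (p + 1)))"
      by (intro mult_left_mono) auto
    also have "\<dots> = 64 * (L powr (- 6) * L powr (6 - 6 / (p + 1)))" by (simp only: mult.left_commute)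
    also have "L powr (- 6) * L powr (6 - 6 / (p + 1)) = L powr (- (6 / (p + 1)))"
      unfolding powr_add[symmetric] by simp
    finally show ?thesis by simp
  qed
  then have "real n powr (- ((p - 2) / (p + 1))) * L powr (- 6) \<le>
     real n powr (- ((p - 2) / (p + 1))) * (64 * L powr (- (6 / (p + 1))))"
    by (intro mult_left_mono) auto
  then show ?thesis unfolding ys L_def by (simp only: mult.left_commute)
qed

text \<open>The scale \<open>v = n powr (1 / (p + 2))\<close> solves
  \<open>v ^ 3 / n = v powr (- (p - 1))\<close>. Either the minimum of \<open>y0\<close> and
  \<open>y_star p n\<close> reaches \<open>v / b\<close> and the first term suffices, or
  \<open>y0\<close> itself is below \<open>v\<close>, since \<open>y_star p n\<close> is not below
  \<open>v / b\<close>, and the second term suffices.\<close>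

lemma optimal_rate_le:
  fixes p :: real
  assumes p: "p > 1" and n: "n \<ge> 2" and y0: "y0 \<ge> 1"
  shows "real n powr (- ((p - 1) / (p + 2))) \<le>
    (2 * (p + 2)) ^ 6 * (enat_min_real y0 (y_star p n) ^ 3 / real n + enat_powr_minus y0 (p - 1))"
proof -
  define b where "b = (2 * (p + 2))\<^sup>2"
  define v where "v = real n powr (1 / (p + 2))"
  define w where "w = enat_min_real y0 (y_star p n)"
  have n0: "real n > 0" using n by simp
  have b: "b \<ge> 1" using p by (simp add: b_def one_le_power)
  have b3: "(2 * (p + 2)) ^ 6 = b ^ 3" by (simp add: b_def power_mult[symmetric])
  have v: "v > 0" using n0 by (simp add: v_def)
  have rate: "real n powr (- ((p - 1) / (p + 2))) = v powr (- (p - 1))"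
    by (simp add: v_def powr_powr minus_divide_left)
  have vn: "v powr (- (p - 1)) = v ^ 3 / real n"
  proof -
    have "v powr (- (p - 1)) = v powr (3 - (p + 2))" by simp
    also have "\<dots> = v powr 3 / v powr (p + 2)" by (rule powr_diff)
    also have "v powr (p + 2) = real n" using p n0 by (simp add: v_def powr_powr)
    finally show ?thesis using v by simp
  qed
  have pm: "0 \<le> enat_powr_minus y0 (p - 1)" by (simp add: enat_powr_minus_def split: enat.split)
  have w0: "0 \<le> w" using y_star_ge_one[OF p n] by (simp add: w_def enat_min_real_def split: enat.split)
  show ?thesis
  proof (cases "v / b \<le> w")
    case True
    then have "v \<le> b * w" using b by (simp add: field_simps)
    then have "v ^ 3 \<le> (b * w) ^ 3" using v by (intro power_mono) auto
    then have "v ^ 3 / real n \<le> (b * w) ^ 3 / real n" using n0 by (intro divide_right_mono) auto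
    also have "\<dots> = b ^ 3 * (w ^ 3 / real n)" by (simp add: power_mult_distrib)
    also have "\<dots> \<le> b ^ 3 * (w ^ 3 / real n + enat_powr_minus y0 (p - 1))"
      using b pm by (intro mult_left_mono) auto
    finally show ?thesis unfolding rate vn b3 w_def .
  next
    case False
    moreover have "v / b \<le> y_star p n" using y_star_ge[OF p n] by (simp add: v_def b_def)
    ultimately obtain k where k: "y0 = enat k" "real k < v / b"
      by (cases y0) (auto simp: w_def enat_min_real_def min_def split: if_splits)
    have "v / b \<le> v" using v b by (simp add: field_simps)
    then have kv: "real k \<le> v" "real k > 0" using k y0 by (auto simp: one_enat_def)
    have "v powr (- (p - 1)) \<le> real k powr (- (p - 1))" using kv p by (intro powr_mono2') auto
    also have "\<dots> = 1 * enat_powr_minus y0 (p - 1)" by (simp add: k enat_powr_minus_def)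
    also have "\<dots> \<le> b ^ 3 * (w ^ 3 / real n + enat_powr_minus y0 (p - 1))"
      using b pm w0 n0 by (intro mult_mono one_le_power) auto
    finally show ?thesis unfolding rate b3 w_def .
  qed
qed

theorem theorem6:
  fixes p :: real
  assumes "p > 1"
  shows
    "(\<exists>C::real. C > 0 \<and> (\<forall>n::nat. n \<ge> 2 \<longrightarrow>
        (INF y0\<in>{1::enat..}. robbins_regret p n y0)
          \<le> ereal (C * real n powr (- ((p - 1) / (p + 2)))
                     * ln (real n) powr (3 * (p - 1) / (p + 2))))) \<and>
     (\<exists>c::real. c > 0 \<and> (\<forall>n::nat. n \<ge> 2 \<longrightarrow>
        (\<forall>y0::enat. y0 \<ge> 1 \<longrightarrow>
           robbins_regret p n y0
             \<ge> ereal (c * (enat_min_real y0 (y_star p n) ^ 3 / real n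
                            + enat_powr_minus y0 (p - 1)))) \<and>
        robbins_regret p n \<infinity>
          \<ge> ereal (c * real n powr (- ((p - 2) / (p + 1))) * ln (real n) powr (- 6)) \<and>
        (INF y0\<in>{1::enat..}. robbins_regret p n y0)
          \<ge> ereal (c * real n powr (- ((p - 1) / (p + 2))))))"
proof (rule conjI[OF robbins_regret_upper[OF assms]])
  obtain d where d: "d > 0" "\<And>n y0. n \<ge> 2 \<Longrightarrow> y0 \<ge> 1 \<Longrightarrow>
    robbins_regret p n y0 \<ge> ereal (d * (enat_min_real y0 (y_star p n) ^ 3 / real n + enat_powr_minus y0 (p - 1)))"
    using robbins_regret_lower[OF assms] by blast
  define b where "b = (2 * (p + 2)) ^ 6"
  have b: "b \<ge> 64"
    using assms power_mono[of 2 "2 * (p + 2)" 6] by (simp add: b_def)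
  \<comment> \<open>One constant serves all three lower bounds: \<open>b\<close> is the loss in the
    optimal rate, and \<open>b \<ge> 64\<close> covers the loss in the untruncated one.\<close>
  define c where "c = d / b"
  have c: "c > 0" "c \<le> d" "c * b = d" using b d(1) by (simp_all add: c_def field_simps)
  have lower: "robbins_regret p n y0 \<ge> ereal r"
    if "n \<ge> 2" "y0 \<ge> 1" "r \<le> d * (enat_min_real y0 (y_star p n) ^ 3 / real n + enat_powr_minus y0 (p - 1))" for n y0 r
    using d(2)[OF that(1,2)] that(3) by (meson ereal_less_eq(3) order_trans)
  have nonneg: "0 \<le> enat_min_real y0 (y_star p n) ^ 3 / real n + enat_powr_minus y0 (p - 1)"
    if "n \<ge> 2" for n y0
    using y_star_ge_one[OF assms that]
    by (auto simp: enat_min_real_def enat_powr_minus_def split: enat.split intro!: add_nonneg_nonneg)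
  show "\<exists>c::real. c > 0 \<and> (\<forall>n::nat. n \<ge> 2 \<longrightarrow>
        (\<forall>y0::enat. y0 \<ge> 1 \<longrightarrow>
           robbins_regret p n y0
             \<ge> ereal (c * (enat_min_real y0 (y_star p n) ^ 3 / real n
                            + enat_powr_minus y0 (p - 1)))) \<and>
        robbins_regret p n \<infinity>
          \<ge> ereal (c * real n powr (- ((p - 2) / (p + 1))) * ln (real n) powr (- 6)) \<and>
        (INF y0\<in>{1::enat..}. robbins_regret p n y0)
          \<ge> ereal (c * real n powr (- ((p - 1) / (p + 2)))))"
  proof (intro exI[of _ c] conjI allI impI c(1) lower INF_greatest)
    fix n :: nat and y0 :: enat assume n: "n \<ge> 2" and y0: "y0 \<ge> 1"
    show "c * (enat_min_real y0 (y_star p n) ^ 3 / real n + enat_powr_minus y0 (p - 1)) \<le>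
      d * (enat_min_real y0 (y_star p n) ^ 3 / real n + enat_powr_minus y0 (p - 1))"
      by (rule mult_right_mono[OF c(2) nonneg[OF n]])
  next
    fix n :: nat assume n: "n \<ge> 2"
    have "c * real n powr (- ((p - 2) / (p + 1))) * ln (real n) powr (- 6) \<le> c * (64 * (y_star p n ^ 3 / real n))"
      unfolding mult.assoc using untruncated_rate_le[OF assms n] c by (intro mult_left_mono) auto
    also have "\<dots> \<le> c * (b * (y_star p n ^ 3 / real n))"
      using b c y_star_ge_one[OF assms n] by (intro mult_left_mono mult_right_mono) auto
    also have "\<dots> = d * (y_star p n ^ 3 / real n)" using c(3) by (simp only: mult.assoc[symmetric])
    finally show "c * real n powr (- ((p - 2) / (p + 1))) * ln (real n) powr (- 6) \<le>
      d * (enat_min_real \<infinity> (y_star p n) ^ 3 / real n + enat_powr_minus \<infinity> (p - 1))"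
      by (simp add: enat_min_real_def enat_powr_minus_def)
  next
    fix n :: nat and y0 :: enat assume n: "n \<ge> 2" and y0: "y0 \<in> {1..}"
    then have "c * real n powr (- ((p - 1) / (p + 2))) \<le>
      c * (b * (enat_min_real y0 (y_star p n) ^ 3 / real n + enat_powr_minus y0 (p - 1)))"
      unfolding b_def using c by (intro mult_left_mono optimal_rate_le assms) auto
    also have "\<dots> = d * (enat_min_real y0 (y_star p n) ^ 3 / real n + enat_powr_minus y0 (p - 1))"
      using c(3) by (simp only: mult.assoc[symmetric])
    finally show "c * real n powr (- ((p - 1) / (p + 2))) \<le>
      d * (enat_min_real y0 (y_star p n) ^ 3 / real n + enat_powr_minus y0 (p - 1))" .
  qed auto
qed

end
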